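(* Let $1\le q<s$ be integers. Let $\Sigma(q,s)$ be the full simplex whose vertex set is the edge set of the complete bipartite graph with bipartition $[q]\cup[\bar s]$, where $[\bar s]=\{\bar1,\ldots,\bar s\}$. Let $\mathrm{NBFC}(q,s)$ be the subcomplex consisting of the edge sets of all bipartite graphs on $[q]\cup[\bar s]$ that are not $q$-factor critical, and let $\mathrm{BFC}(q,s)=\Sigma(q,s)/\mathrm{NBFC}(q,s)$ be the quotient CW-complex. Then $\mathrm{BFC}(q,s)$ is homotopy equivalent to a wedge of $\binom{s-1}{q}$ spheres of dimension $2q-1$.
   Context: A bipartite graph $G$ with bipartition $X\cup Y$ is called $q$-factor critical if $|X|=q$, $|Y|>q$, and for each $y\in Y$ the graph $G-y$ (delete $y$ and its incident edges) has a matching of size $q$. Here $X=[q]$, $Y=[\bar s]$. For a subcomplex $\Gamma$ of a simplex $\Delta$: if $\Gamma$ is empty then $\Delta/\Gamma=\Delta$; otherwise $\Delta/\Gamma$ is the CW-complex with one point $p_0$ and one $k$-cell for each $k$-dimensional face of $\Delta$ not in $\Gamma$, with boundary portions glued to faces of $\Gamma$ now glued to $p_0$. *)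

theory Defs
  imports "HOL-Analysis.Analysis"
begin

section \<open>Bipartite graphs\<close>

text \<open>
  A bipartite graph on \<open>X \<union> Y\<close> is given by its edge set \<open>E \<subseteq> X \<times> Y\<close>; a pair \<open>(x, y)\<close> is the
  edge joining \<open>x\<close> in the first part to \<open>y\<close> in the second. The two parts are disjoint by
  convention, even when \<open>X\<close> and \<open>Y\<close> overlap as sets.
\<close>

definition matching_in :: "('a \<times> 'b) set \<Rightarrow> ('a \<times> 'b) set \<Rightarrow> bool" where
  "matching_in E M \<longleftrightarrow>
     M \<subseteq> E \<and> (\<forall>e\<in>M. \<forall>f\<in>M. e \<noteq> f \<longrightarrow> fst e \<noteq> fst f \<and> snd e \<noteq> snd f)"

definition delete_right :: "('a \<times> 'b) set \<Rightarrow> 'b \<Rightarrow> ('a \<times> 'b) set" where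
  "delete_right E y = {e \<in> E. snd e \<noteq> y}"

definition factor_critical :: "nat \<Rightarrow> 'a set \<Rightarrow> 'b set \<Rightarrow> ('a \<times> 'b) set \<Rightarrow> bool" where
  "factor_critical q X Y E \<longleftrightarrow>
     finite X \<and> finite Y \<and> E \<subseteq> X \<times> Y \<and> card X = q \<and> card Y > q \<and>
     (\<forall>y\<in>Y. \<exists>M. matching_in (delete_right E y) M \<and> finite M \<and> card M = q)"

section \<open>Simplicial complexes and their quotients\<close>

text \<open>
  A finite abstract simplicial complex is a finite, downward closed set of finite sets. Its
  realization consists of the barycentric coordinate vectors supported on a face (the empty face
  contributes no point). For finite complexes the topology of pointwise convergence used here is
  the usual one; it is also the topology underlying \<^const>\<open>Euclidean_space\<close> and \<^const>\<open>nsphere\<close>.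
\<close>

definition realization :: "'v set set \<Rightarrow> ('v \<Rightarrow> real) topology" where
  "realization K = subtopology (powertop_real UNIV)
     {x. (\<forall>v. 0 \<le> x v) \<and> {v. x v \<noteq> 0} \<in> K \<and> (\<Sum>v | x v \<noteq> 0. x v) = 1}"

definition quotient_topology :: "'a topology \<Rightarrow> ('a \<Rightarrow> 'b) \<Rightarrow> 'b topology" where
  "quotient_topology X f =
     topology (\<lambda>U. U \<subseteq> f ` topspace X \<and> openin X {x \<in> topspace X. f x \<in> U})"

lemma openin_quotient_topology:
  "openin (quotient_topology X f) U \<longleftrightarrow>
     U \<subseteq> f ` topspace X \<and> openin X {x \<in> topspace X. f x \<in> U}"
proof -
  have int: "{x \<in> topspace X. f x \<in> S \<inter> T}
      = {x \<in> topspace X. f x \<in> S} \<inter> {x \<in> topspace X. f x \<in> T}" for S T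
    by auto
  have un: "{x \<in> topspace X. f x \<in> \<Union>\<K>} = (\<Union>S\<in>\<K>. {x \<in> topspace X. f x \<in> S})" for \<K>
    by auto
  have "istopology (\<lambda>U. U \<subseteq> f ` topspace X \<and> openin X {x \<in> topspace X. f x \<in> U})"
    unfolding istopology_def int un by (auto intro!: openin_Int openin_Union)
  then show ?thesis
    by (simp add: quotient_topology_def topology_inverse')
qed

lemma topspace_quotient_topology [simp]: "topspace (quotient_topology X f) = f ` topspace X"
proof (rule antisym)
  show "topspace (quotient_topology X f) \<subseteq> f ` topspace X"
    by (meson openin_quotient_topology openin_topspace)
  have "{x \<in> topspace X. f x \<in> f ` topspace X} = topspace X"
    by auto
  then have "openin (quotient_topology X f) (f ` topspace X)"
    by (simp add: openin_quotient_topology)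
  then show "f ` topspace X \<subseteq> topspace (quotient_topology X f)"
    by (rule openin_subset)
qed

lemma quotient_map_quotient_topology: "quotient_map X (quotient_topology X f) f"
  by (simp add: quotient_map_def openin_quotient_topology)

text \<open>
  \<open>collapse X A\<close> is the quotient of \<open>X\<close> by the relation identifying all points of \<open>A\<close>: the point
  \<open>None\<close> is the image of \<open>A\<close>, and is present only if \<open>A\<close> is nonempty. Hence collapsing the empty
  set returns the original space, up to homeomorphism.
\<close>

definition collapse :: "'a topology \<Rightarrow> 'a set \<Rightarrow> 'a option topology" where
  "collapse X A = quotient_topology X (\<lambda>x. if x \<in> A then None else Some x)"

lemma collapse_empty: "X homeomorphic_space collapse X {}"
proof -
  have "quotient_map X (collapse X {}) (\<lambda>x. Some x)"
    using quotient_map_quotient_topology[of X "\<lambda>x. if x \<in> {} then None else Some x"]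
    by (simp add: collapse_def)
  then show ?thesis
    by (meson homeomorphic_map_def homeomorphic_map_imp_homeomorphic_space inj_Some inj_on_subset
        subset_UNIV)
qed

definition quotient_complex :: "'v set set \<Rightarrow> 'v set set \<Rightarrow> ('v \<Rightarrow> real) option topology" where
  "quotient_complex \<Delta> \<Gamma> = collapse (realization \<Delta>) (topspace (realization \<Gamma>))"

text \<open>
  The wedge of a nonempty family of pointed spaces (for empty \<open>I\<close> this yields the empty space).
\<close>

definition wedge :: "'i set \<Rightarrow> ('i \<Rightarrow> 'a topology) \<Rightarrow> ('i \<Rightarrow> 'a) \<Rightarrow> ('i \<times> 'a) option topology" where
  "wedge I X b = collapse (sum_topology X I) {(i, b i) | i. i \<in> I}"

definition sphere_basepoint :: "nat \<Rightarrow> real" where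
  "sphere_basepoint = (\<lambda>i. if i = 0 then 1 else 0)"

lemma sphere_basepoint_in_nsphere: "sphere_basepoint \<in> topspace (nsphere n)"
  unfolding sphere_basepoint_def by (rule in_topspace_nsphere)

definition wedge_of_spheres :: "nat \<Rightarrow> nat \<Rightarrow> (nat \<times> (nat \<Rightarrow> real)) option topology" where
  "wedge_of_spheres m d = wedge {..<m} (\<lambda>_. nsphere d) (\<lambda>_. sphere_basepoint)"

section \<open>The complexes of bipartite graphs\<close>

text \<open>Both parts are initial segments of \<^typ>\<open>nat\<close>; a pair \<open>(i, j)\<close> is the edge from \<open>i\<close> to the
  barred vertex \<open>j\<close>. Graphs are identified with their edge sets.\<close>

definition full_simplex :: "nat \<Rightarrow> nat \<Rightarrow> (nat \<times> nat) set set" where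
  "full_simplex q s = Pow ({1..q} \<times> {1..s})"

definition NBFC :: "nat \<Rightarrow> nat \<Rightarrow> (nat \<times> nat) set set" where
  "NBFC q s = {E. E \<subseteq> {1..q} \<times> {1..s} \<and> \<not> factor_critical q {1..q} {1..s} E}"

lemma NBFC_subset: "NBFC q s \<subseteq> full_simplex q s"
  by (auto simp: NBFC_def full_simplex_def)

lemma NBFC_downward_closed:
  assumes "E \<in> NBFC q s" "F \<subseteq> E"
  shows "F \<in> NBFC q s"
proof -
  have "matching_in (delete_right E y) M" if "matching_in (delete_right F y) M" for y M
    using that assms(2) by (auto simp: matching_in_def delete_right_def)
  then show ?thesis
    using assms unfolding NBFC_def factor_critical_def by blast
qed

definition BFC :: "nat \<Rightarrow> nat \<Rightarrow> (nat \<times> nat \<Rightarrow> real) option topology" where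
  "BFC q s = quotient_complex (full_simplex q s) (NBFC q s)"

end

theory Submission
  imports Defs
begin

text \<open>
  By Hall's theorem a graph is \<open>q\<close>-factor critical iff every nonempty set \<open>S\<close> of left vertices has at
  least \<open>|S| + 1\<close> neighbours. The faces of the simplex outside \<open>NBFC q s\<close> carry an acyclic matching
  all of whose critical faces have \<open>2 * q\<close> edges. Let \<open>x\<close> be the last left vertex and \<open>y0\<close> the first
  right vertex. Toggling the edge \<open>(x, y0)\<close> and then, for the least vertex \<open>c\<close> of a suitable class of right
  vertices, the edge \<open>(x, c)\<close>, leaves the graphs in which \<open>x\<close> is joined exactly to \<open>y0\<close> and \<open>c\<close>.
  If \<open>c\<close> is deleted from such a graph and the other left vertices still have at least \<open>q\<close> neighbours,
  some left vertex lies in no tight set and its edge to \<open>c\<close> can be toggled; otherwise the remaining graph is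
  factor critical on these \<open>q - 1\<close> neighbours and \<open>c\<close>, and induction applies.

  Since the critical faces have the same dimension, the matched pairs below that dimension can be
  collapsed first, enlarging the subcomplex, and those above it can be collapsed last. What remains is
  the quotient of a complex by a subcomplex containing all its faces except the critical ones, and this is
  a wedge of spheres. Each elementary collapse is realized by a homotopy of the whole simplex, so
  no homotopy extension argument is needed.
\<close>

section \<open>Acyclic matchings on families of sets\<close>

text \<open>Both toggling arguments rest on submodularity of neighbourhood counts. Cohesive sets
  that meet have a cohesive union, so a class does not depend on the set representing it and
  survives toggling the edge to its least element. Tight sets are closed under union, so a left side
  that is not itself tight has a vertex outside all of them.

  Each level of the recursion fixes two edges at one left vertex and hands one of the two right ends
  to the next level. The critical graphs are therefore paths through all left vertices, determined
  by their \<open>q\<close> right vertices other than the first; this explains both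
  \<open>2 * q\<close> and the binomial coefficient.

  The collapses can be reordered by size because nested faces of equal size coincide, so ties at
  \<open>2 * q\<close> between matched and critical faces do no harm. A pair may be added to the
  collapsed subcomplex even if its smaller face has further cofaces in the simplex: the deformation
  maps the simplex to itself, and beyond that only the subcomplexes have to be respected.\<close>

text \<open>
  \<open>matchable Q C\<close>: \<open>Q\<close> has a perfect matching by pairs \<open>(s, insert v s)\<close> outside \<open>C\<close>; the side condition
  of \<open>union\<close> makes the matching acyclic.
\<close>

inductive matchable :: "'v set set \<Rightarrow> 'v set set \<Rightarrow> bool" where
  empty: "matchable {} {}"
| critical: "matchable {s} {s}"
| pair: "v \<notin> s \<Longrightarrow> matchable {s, insert v s} {}"
| union: "matchable Q C \<Longrightarrow> matchable Q' C' \<Longrightarrow> (\<And>F F'. F \<in> Q \<Longrightarrow> F' \<in> Q' \<Longrightarrow> \<not> F' \<subseteq> F)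
    \<Longrightarrow> matchable (Q \<union> Q') (C \<union> C')"

lemma matchable_critical_subset: "matchable Q C \<Longrightarrow> C \<subseteq> Q"
  by (induction rule: matchable.induct) auto

text \<open>Patchwork principle: the fibre over a maximal value can be put on top, since
  monotonicity of \<open>f\<close> forbids one of its faces to lie below a face with another
  value.\<close>

lemma matchable_fibres:
  fixes f :: "'v set \<Rightarrow> 'b::order"
  assumes "finite Q"
    and "\<And>F F'. F \<in> Q \<Longrightarrow> F' \<in> Q \<Longrightarrow> F \<subseteq> F' \<Longrightarrow> f F \<le> f F'"
    and "\<And>y. y \<in> f ` Q \<Longrightarrow> matchable {F \<in> Q. f F = y} (C y)"
  shows "matchable Q (\<Union>y\<in>f ` Q. C y)"
  using assms
proof (induction Q rule: finite_psubset_induct)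
  case (psubset Q)
  show ?case
  proof (cases "Q = {}")
    case True
    then show ?thesis by (simp add: matchable.empty)
  next
    case False
    then obtain m where m: "m \<in> f ` Q" "\<And>y. y \<in> f ` Q \<Longrightarrow> m \<le> y \<Longrightarrow> y = m"
      using finite_has_maximal[of "f ` Q"] psubset.hyps by (metis finite_imageI image_is_empty)
    define Q1 where "Q1 = {F \<in> Q. f F \<noteq> m}"
    have im: "f ` Q = f ` Q1 \<union> {m}" and Q: "Q = Q1 \<union> {F \<in> Q. f F = m}"
      using m(1) by (auto simp: Q1_def)
    have fib: "{F \<in> Q1. f F = y} = {F \<in> Q. f F = y}" if "y \<in> f ` Q1" for y
      using that by (auto simp: Q1_def)
    have "Q1 \<subset> Q"
      using m(1) by (auto simp: Q1_def)
    then have "matchable Q1 (\<Union>y\<in>f ` Q1. C y)"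
    proof (rule psubset.IH)
      show "f F \<le> f F'" if "F \<in> Q1" "F' \<in> Q1" "F \<subseteq> F'" for F F'
        using that psubset.prems(1) by (simp add: Q1_def)
      show "matchable {F \<in> Q1. f F = y} (C y)" if "y \<in> f ` Q1" for y
        using that psubset.prems(2) fib im by simp
    qed
    moreover have "matchable {F \<in> Q. f F = m} (C m)"
      using psubset.prems(2) m(1) by blast
    moreover have "\<not> F' \<subseteq> F" if "F \<in> Q1" "F' \<in> {F \<in> Q. f F = m}" for F F'
      using that psubset.prems(1)[of F' F] m(2)[of "f F"] by (auto simp: Q1_def)
    ultimately have "matchable (Q1 \<union> {F \<in> Q. f F = m}) ((\<Union>y\<in>f ` Q1. C y) \<union> C m)"
      by (rule matchable.union)
    then show ?thesis
      using Q by (simp add: im Un_commute)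
  qed
qed

corollary matchable_fibres_index:
  fixes f :: "'v set \<Rightarrow> 'b::order"
  assumes "finite Q"
    and "\<And>F F'. F \<in> Q \<Longrightarrow> F' \<in> Q \<Longrightarrow> F \<subseteq> F' \<Longrightarrow> f F \<le> f F'"
    and "f ` Q \<subseteq> I"
    and "\<And>y. y \<in> I \<Longrightarrow> matchable {F \<in> Q. f F = y} (C y)"
  shows "matchable Q (\<Union>y\<in>I. C y)"
proof -
  \<comment> \<open>Indices with an empty fibre contribute nothing, because critical faces belong to
    the matched family.\<close>
  have "C y = {}" if "y \<in> I - f ` Q" for y
    using matchable_critical_subset[OF assms(4)[of y]] that by auto
  then have "(\<Union>y\<in>I. C y) = (\<Union>y\<in>f ` Q. C y)"
    using assms(3) by blast
  moreover have "matchable Q (\<Union>y\<in>f ` Q. C y)"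
    using assms by (intro matchable_fibres) auto
  ultimately show ?thesis by simp
qed

lemma matchable_toggle:
  assumes "finite Q" "\<And>F. F \<in> Q \<Longrightarrow> insert v F \<in> Q" "\<And>F. F \<in> Q \<Longrightarrow> F - {v} \<in> Q"
  shows "matchable Q {}"
proof -
  \<comment> \<open>The map removing \<open>v\<close> is monotone, and each of its fibres is a
    single pair.\<close>
  have "matchable {F \<in> Q. F - {v} = G} {}" if G: "G \<in> (\<lambda>F. F - {v}) ` Q" for G
  proof -
    have "G \<in> Q" "v \<notin> G" "insert v G \<in> Q"
      using G assms(2)[of G] assms(3) by auto
    moreover have "F = G \<or> F = insert v G" if "F - {v} = G" for F
      using that by auto
    ultimately have "{F \<in> Q. F - {v} = G} = {G, insert v G}"
      by auto
    then show ?thesis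
      using matchable.pair[OF \<open>v \<notin> G\<close>] by simp
  qed
  then have "matchable Q (\<Union>G\<in>(\<lambda>F. F - {v}) ` Q. {})"
    by (intro matchable_fibres assms(1)) auto
  then show ?thesis by simp
qed

text \<open>Adding one disjoint set to all faces preserves and reflects inclusion. This carries a
  matching for the smaller graphs over to graphs with fixed edges at the last left vertex.\<close>

lemma matchable_image_Un:
  assumes "matchable Q C" "\<And>F. F \<in> Q \<Longrightarrow> F \<inter> D = {}"
  shows "matchable ((\<union>) D ` Q) ((\<union>) D ` C)"
  using assms
proof (induction rule: matchable.induct)
  case empty
  show ?case by (simp add: matchable.empty)
next
  case (critical s)
  show ?case by (simp add: matchable.critical)
next
  case (pair v s)
  then have "v \<notin> D \<union> s" by auto
  then show ?case using matchable.pair[of v "D \<union> s"] by simp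
next
  case (union Q C Q' C')
  have "\<not> D \<union> G' \<subseteq> D \<union> G" if "G \<in> Q" "G' \<in> Q'" for G G'
  proof -
    have "\<not> G' \<subseteq> G" "G' \<inter> D = {}"
      using that union.hyps(3) union.prems by auto
    then show ?thesis by blast
  qed
  then show ?case
    unfolding image_Un using union.IH union.prems by (intro matchable.union) auto
qed

text \<open>The members of a pair differ by one element, so no pair straddles size \<open>n\<close>:
  both members have at most \<open>n\<close> elements or both have at least
  \<open>n\<close>.\<close>

lemma matchable_split:
  assumes "matchable Q C" "\<And>c. c \<in> C \<Longrightarrow> card c = n" "\<And>F. F \<in> Q \<Longrightarrow> finite F"
  shows "\<exists>A B. Q = A \<union> C \<union> B \<and> A \<inter> C = {} \<and> B \<inter> (A \<union> C) = {} \<and> matchable A {} \<and> matchable B {}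
    \<and> (\<forall>a\<in>A. card a \<le> n) \<and> (\<forall>b\<in>B. n \<le> card b)"
  using assms
proof (induction rule: matchable.induct)
  case empty
  show ?case by (rule exI[of _ "{}"])+ (simp add: matchable.empty)
next
  case (critical s)
  show ?case by (rule exI[of _ "{}"])+ (simp add: matchable.empty)
next
  case (pair v s)
  then have fs: "finite s" by simp
  show ?case
  proof (cases "card s < n")
    case True
    have "matchable {s, insert v s} {}" "card (insert v s) \<le> n"
      using True pair fs by (auto intro: matchable.pair)
    then show ?thesis
      using True by (intro exI[of _ "{s, insert v s}"] exI[of _ "{}"]) (auto intro: matchable.empty)
  next
    case False
    have "matchable {s, insert v s} {}" "n \<le> card (insert v s)"
      using False pair fs by (auto intro: matchable.pair)
    then show ?thesis
      using False by (intro exI[of _ "{}"] exI[of _ "{s, insert v s}"]) (auto intro: matchable.empty)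
  qed
next
  case (union Q C Q' C')
  obtain A B where 1: "Q = A \<union> C \<union> B" "A \<inter> C = {}" "B \<inter> (A \<union> C) = {}" "matchable A {}" "matchable B {}"
     "\<forall>a\<in>A. card a \<le> n" "\<forall>b\<in>B. n \<le> card b"
    using union.IH(1) union.prems by (metis UnCI)
  obtain A' B' where 2: "Q' = A' \<union> C' \<union> B'" "A' \<inter> C' = {}" "B' \<inter> (A' \<union> C') = {}" "matchable A' {}" "matchable B' {}"
     "\<forall>a\<in>A'. card a \<le> n" "\<forall>b\<in>B'. n \<le> card b"
    using union.IH(2) union.prems by (metis UnCI)
  have disj: "Q \<inter> Q' = {}"
    using union.hyps(3) by blast
  have "matchable (A \<union> A') ({} \<union> {})"
    by (rule matchable.union) (use 1 2 union.hyps(3) in auto)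
  moreover have "matchable (B \<union> B') ({} \<union> {})"
    by (rule matchable.union) (use 1 2 union.hyps(3) in auto)
  ultimately have AB: "matchable (A \<union> A') {}" "matchable (B \<union> B') {}"
    by simp_all
  show ?case
  proof (rule exI[of _ "A \<union> A'"], rule exI[of _ "B \<union> B'"], intro conjI)
    show "Q \<union> Q' = A \<union> A' \<union> (C \<union> C') \<union> (B \<union> B')"
      unfolding 1(1) 2(1) by blast
    have sub: "A \<subseteq> Q" "B \<subseteq> Q" "C \<subseteq> Q" "A' \<subseteq> Q'" "B' \<subseteq> Q'" "C' \<subseteq> Q'"
      unfolding 1(1) 2(1) by blast+
    show "(A \<union> A') \<inter> (C \<union> C') = {}" "(B \<union> B') \<inter> (A \<union> A' \<union> (C \<union> C')) = {}"
      using 1(2,3) 2(2,3) sub disj by blast+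
  qed (use 1 2 AB in auto)
qed

section \<open>Hall's theorem and graphs of positive surplus\<close>

lemma card_Un_Int_le:
  assumes "finite A" "finite B" "C \<subseteq> A \<inter> B"
  shows "card (A \<union> B) + card C \<le> card A + card B"
  using card_Un_Int[OF assms(1,2)] card_mono[of "A \<inter> B" C] assms by auto

lemma hall:
  assumes "finite X" "finite E" "\<And>S. S \<subseteq> X \<Longrightarrow> card S \<le> card (E `` S)"
  shows "\<exists>M. matching_in E M \<and> finite M \<and> card M = card X"
  using assms(2,3)
proof (induction E rule: finite_psubset_induct)
  case (psubset E)
  have finI: "finite (F `` S)" if "F \<subseteq> E" for F and S :: "'a set"
    using finite_subset[OF that psubset.hyps] finite_Image by blast
  show ?case
  proof (cases "\<exists>x y1 y2. x \<in> X \<and> (x, y1) \<in> E \<and> (x, y2) \<in> E \<and> y1 \<noteq> y2")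
    case True
    then obtain x y1 y2 where x: "x \<in> X" and e: "(x, y1) \<in> E" "(x, y2) \<in> E" "y1 \<noteq> y2"
      by blast
    let ?E1 = "E - {(x, y1)}" and ?E2 = "E - {(x, y2)}"
    have "(\<forall>S\<subseteq>X. card S \<le> card (?E1 `` S)) \<or> (\<forall>S\<subseteq>X. card S \<le> card (?E2 `` S))"
    proof (rule ccontr)
      assume "\<not> ?thesis"
      then obtain S1 S2 where S: "S1 \<subseteq> X" "card (?E1 `` S1) < card S1" "S2 \<subseteq> X" "card (?E2 `` S2) < card S2"
        unfolding not_le[symmetric] by blast
      have x1: "x \<in> S1"
      proof (rule ccontr)
        assume "x \<notin> S1"
        then have "?E1 `` S1 = E `` S1" by auto
        then show False using S psubset.prems[of S1] by simp
      qed
      have x2: "x \<in> S2"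
      proof (rule ccontr)
        assume "x \<notin> S2"
        then have "?E2 `` S2 = E `` S2" by auto
        then show False using S psubset.prems[of S2] by simp
      qed
      have fS: "finite S1" "finite S2"
        using S assms(1) finite_subset by auto
      \<comment> \<open>\<open>x\<close> still reaches \<open>y2\<close> in \<open>?E1\<close> and
        \<open>y1\<close> in \<open>?E2\<close>, so the union loses nothing. Two violating sets
        would lose at least 2 in total, but submodularity allows only 1, caused by removing
        \<open>x\<close> from the intersection.\<close>
      have "?E1 `` S1 \<union> ?E2 `` S2 = E `` (S1 \<union> S2)"
        using x1 x2 e by auto
      moreover have "E `` (S1 \<inter> S2 - {x}) \<subseteq> ?E1 `` S1 \<inter> ?E2 `` S2"
        by auto
      ultimately have "card (E `` (S1 \<union> S2)) + card (E `` (S1 \<inter> S2 - {x})) \<le> card (?E1 `` S1) + card (?E2 `` S2)"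
        using card_Un_Int_le[of "?E1 `` S1" "?E2 `` S2"] finI by (metis Diff_subset)
      moreover have "card (S1 \<union> S2) \<le> card (E `` (S1 \<union> S2))"
        "card (S1 \<inter> S2 - {x}) \<le> card (E `` (S1 \<inter> S2 - {x}))"
        using S by (auto intro!: psubset.prems)
      moreover have "card (S1 \<inter> S2 - {x}) + 1 = card (S1 \<inter> S2)"
        using x1 x2 fS by (metis IntI Suc_eq_plus1 card_Suc_Diff1 finite_Int)
      moreover have "card (S1 \<union> S2) + card (S1 \<inter> S2) = card S1 + card S2"
        using card_Un_Int[OF fS] by simp
      ultimately show False using S by linarith
    qed
    then obtain E' where "E' \<subset> E" "\<And>S. S \<subseteq> X \<Longrightarrow> card S \<le> card (E' `` S)"
    proof
      assume "\<forall>S\<subseteq>X. card S \<le> card (?E1 `` S)"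
      then show thesis using e by (intro that[of ?E1]) auto
    next
      assume "\<forall>S\<subseteq>X. card S \<le> card (?E2 `` S)"
      then show thesis using e by (intro that[of ?E2]) auto
    qed
    then obtain M where "matching_in E' M" "finite M" "card M = card X"
      using psubset.IH by blast
    moreover from this have "matching_in E M"
      using \<open>E' \<subset> E\<close> unfolding matching_in_def by blast
    ultimately show ?thesis by blast
  next
    case False
    have "\<exists>y. (x, y) \<in> E" if "x \<in> X" for x
      using psubset.prems[of "{x}"] that by (cases "E `` {x} = {}") auto
    then obtain g where g: "\<And>x. x \<in> X \<Longrightarrow> (x, g x) \<in> E"
      by metis
    have im: "E `` S = g ` S" if "S \<subseteq> X" for S
    proof
      have "y = g x" if "(x, y) \<in> E" "x \<in> X" for x y
        using False g that by blast
      then show "E `` S \<subseteq> g ` S"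
        using that by blast
      show "g ` S \<subseteq> E `` S"
        using g that by blast
    qed
    have "g x \<noteq> g x'" if "x \<in> X" "x' \<in> X" "x \<noteq> x'" for x x'
    proof
      assume "g x = g x'"
      then have "E `` {x, x'} = {g x}"
        using im[of "{x, x'}"] that by simp
      then show False
        using psubset.prems[of "{x, x'}"] that by simp
    qed
    then have "matching_in E ((\<lambda>x. (x, g x)) ` X)"
      using g unfolding matching_in_def by fastforce
    moreover have "card ((\<lambda>x. (x, g x)) ` X) = card X"
      by (intro card_image) (auto simp: inj_on_def)
    ultimately show ?thesis
      using assms(1) by blast
  qed
qed

text \<open>The right side is an arbitrary set because the recursion restricts to subsets of it,
  whereas left vertices are always removed from the top.\<close>

definition surplus_graphs :: "nat \<Rightarrow> nat set \<Rightarrow> (nat \<times> nat) set set" where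
  "surplus_graphs q Y =
     {E. E \<subseteq> {1..q} \<times> Y \<and> (\<forall>S\<subseteq>{1..q}. S \<noteq> {} \<longrightarrow> card S < card (E `` S))}"

lemma matching_in_card_Image:
  assumes "matching_in E M" "finite E" "E \<subseteq> X \<times> Y" "finite X" "card M = card X" "S \<subseteq> X"
  shows "card S \<le> card (E `` S)"
proof -
  have M: "M \<subseteq> E" "inj_on fst M" "inj_on snd M"
    using assms(1) unfolding matching_in_def inj_on_def by blast+
  then have "fst ` M \<subseteq> X" "card (fst ` M) = card X"
    using assms by (auto simp: card_image)
  then have "fst ` M = X"
    using assms(4) card_subset_eq by blast
  moreover have "fst ` {e \<in> M. fst e \<in> S} = fst ` M \<inter> S"
    by auto
  ultimately have "fst ` {e \<in> M. fst e \<in> S} = S"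
    using assms(6) by blast
  moreover have "card (fst ` {e \<in> M. fst e \<in> S}) = card {e \<in> M. fst e \<in> S}"
    by (rule card_image, rule inj_on_subset[OF M(2)]) blast
  moreover have "card (snd ` {e \<in> M. fst e \<in> S}) = card {e \<in> M. fst e \<in> S}"
    by (rule card_image, rule inj_on_subset[OF M(3)]) blast
  ultimately have "card S = card (snd ` {e \<in> M. fst e \<in> S})"
    by simp
  also have "\<dots> \<le> card (E `` S)"
  proof (intro card_mono finite_Image assms(2))
    show "snd ` {e \<in> M. fst e \<in> S} \<subseteq> E `` S"
      using M(1) by force
  qed
  finally show ?thesis .
qed

lemma finite_surplus_graph: "E \<in> surplus_graphs q Y \<Longrightarrow> finite Y \<Longrightarrow> finite E"
  by (rule finite_subset[of _ "{1..q} \<times> Y"]) (simp_all add: surplus_graphs_def)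

lemma surplus_graphs_subset: "E \<in> surplus_graphs q Y \<Longrightarrow> E \<subseteq> {1..q} \<times> Y"
  by (simp add: surplus_graphs_def)

lemma surplus_graphs_card: "E \<in> surplus_graphs q Y \<Longrightarrow> S \<subseteq> {1..q} \<Longrightarrow> S \<noteq> {} \<Longrightarrow> card S < card (E `` S)"
  by (simp add: surplus_graphs_def)

lemma finite_surplus_graphs: "finite Y \<Longrightarrow> finite (surplus_graphs q Y)"
  by (rule finite_subset[of _ "Pow ({1..q} \<times> Y)"]) (use surplus_graphs_subset in blast, simp)

text \<open>Deleting a right vertex costs a neighbourhood at most one element, so positive surplus
  gives Hall's condition after every deletion. Conversely, the surplus of \<open>S\<close> is seen
  by deleting a neighbour of \<open>S\<close>.\<close>

lemma factor_critical_iff_surplus: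
  assumes "q < s"
  shows "factor_critical q {1..q} {1..s} E \<longleftrightarrow> E \<in> surplus_graphs q {1..s}"
proof
  assume fc: "factor_critical q {1..q} {1..s} E"
  then have E: "E \<subseteq> {1..q} \<times> {1..s}" by (simp add: factor_critical_def)
  then have finE: "finite E" by (rule finite_subset) simp
  have "card S < card (E `` S)" if S: "S \<subseteq> {1..q}" "S \<noteq> {}" for S
  proof -
    have hall: "card S \<le> card (delete_right E y `` S)" if "y \<in> {1..s}" for y
    proof -
      have "\<forall>y\<in>{1..s}. \<exists>M. matching_in (delete_right E y) M \<and> finite M \<and> card M = q"
        using fc unfolding factor_critical_def by (elim conjE)
      from bspec[OF this that] obtain M where M: "matching_in (delete_right E y) M" "card M = q"
        by (elim exE conjE)
      have "finite (delete_right E y)" "delete_right E y \<subseteq> {1..q} \<times> {1..s}"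
        using finE E by (auto simp: delete_right_def)
      then show ?thesis
        using M S(1) by (intro matching_in_card_Image[of _ M "{1..q}" "{1..s}"]) simp_all
    qed
    \<comment> \<open>Deleting the vertex 1, which exists because \<open>q < s\<close>, already
      shows that \<open>S\<close> has a neighbour; only then can the deleted vertex be chosen among
      the neighbours.\<close>
    have "card S \<noteq> 0"
      using S by (metis card_eq_0_iff finite_atLeastAtMost finite_subset)
    moreover have "delete_right E 1 `` S \<subseteq> E `` S"
      by (auto simp: delete_right_def)
    ultimately have "E `` S \<noteq> {}"
      using hall[of 1] assms by auto
    then obtain y where y: "y \<in> E `` S" by auto
    then have "delete_right E y `` S \<subset> E `` S"
      by (auto simp: delete_right_def)
    then have "card (delete_right E y `` S) < card (E `` S)"
      by (intro psubset_card_mono finite_Image finE)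
    moreover have "y \<in> {1..s}"
      using y E by blast
    ultimately show ?thesis
      using hall[of y] by simp
  qed
  then show "E \<in> surplus_graphs q {1..s}"
    using E by (simp add: surplus_graphs_def)
next
  assume E: "E \<in> surplus_graphs q {1..s}"
  then have finE: "finite E"
    by (rule finite_surplus_graph) simp
  have "\<exists>M. matching_in (delete_right E y) M \<and> finite M \<and> card M = card {1..q}" for y
  proof (rule hall)
    show "finite (delete_right E y)"
      using finE by (simp add: delete_right_def)
    show "card S \<le> card (delete_right E y `` S)" if "S \<subseteq> {1..q}" for S
    proof (cases "S = {}")
      case False
      have "card S < card (E `` S)"
        using E that False by (rule surplus_graphs_card)
      also have "card (E `` S) \<le> card (insert y (delete_right E y `` S))"
        using finE by (intro card_mono finite.insertI finite_Image) (auto simp: delete_right_def)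
      also have "\<dots> \<le> Suc (card (delete_right E y `` S))"
        using finE by (simp add: card_insert_if delete_right_def finite_Image)
      finally show ?thesis by simp
    qed auto
  qed auto
  then show "factor_critical q {1..q} {1..s} E"
    using E assms by (simp add: factor_critical_def surplus_graphs_def)
qed

section \<open>The fibres over the last vertex\<close>

text \<open>
  \<open>A\<close> is cohesive for \<open>E\<close> if adding a further left vertex with neighbourhood \<open>A\<close> destroys the surplus.
  The cohesive sets are the sets contained in a single class of an equivalence relation on the right vertices.
\<close>

definition cohesive :: "nat \<Rightarrow> (nat \<times> nat) set \<Rightarrow> nat set \<Rightarrow> bool" where
  "cohesive q E A \<longleftrightarrow> (\<exists>S\<subseteq>{1..q}. card (E `` S \<union> A) \<le> Suc (card S))"

definition cohesion_class :: "nat \<Rightarrow> nat set \<Rightarrow> (nat \<times> nat) set \<Rightarrow> nat set \<Rightarrow> nat set" where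
  "cohesion_class q Y E B = {b \<in> Y. cohesive q E (insert b B)}"

text \<open>The empty \<open>S\<close> is the witness. This is reflexivity of the relation, and it
  rules out a single vertex as neighbourhood of the new left vertex.\<close>

lemma cohesive_singleton: "cohesive q E {a}"
  unfolding cohesive_def by (intro exI[of _ "{}"]) simp

lemma cohesive_mono:
  assumes "cohesive q E' A'" "E \<subseteq> E'" "A \<subseteq> A'" "finite E'" "finite A'"
  shows "cohesive q E A"
proof -
  obtain S where S: "S \<subseteq> {1..q}" "card (E' `` S \<union> A') \<le> Suc (card S)"
    using assms(1) by (auto simp: cohesive_def)
  have "card (E `` S \<union> A) \<le> card (E' `` S \<union> A')"
    using assms by (intro card_mono finite_UnI finite_Image) auto
  then show ?thesis
    unfolding cohesive_def using S by (intro exI[of _ S]) auto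
qed

text \<open>Uncrossing of the witnesses to \<open>S \<union> T\<close>. The intersection term is at
  least \<open>card (S \<inter> T) + 1\<close>, by the surplus of \<open>E\<close> or, for disjoint
  witnesses, because \<open>A\<close> and \<open>B\<close> meet. This yields transitivity.\<close>

lemma cohesive_Un:
  assumes "E \<in> surplus_graphs q Y" "finite Y" "A \<subseteq> Y" "B \<subseteq> Y" "A \<inter> B \<noteq> {}"
    and "cohesive q E A" "cohesive q E B"
  shows "cohesive q E (A \<union> B)"
proof -
  obtain S T where S: "S \<subseteq> {1..q}" "card (E `` S \<union> A) \<le> Suc (card S)"
    and T: "T \<subseteq> {1..q}" "card (E `` T \<union> B) \<le> Suc (card T)"
    using assms by (auto simp: cohesive_def)
  have finE: "finite E" and fin: "finite A" "finite B" "finite S" "finite T"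
    using assms finite_subset S T finite_surplus_graph by auto
  have "Suc (card (S \<inter> T)) \<le> card (E `` (S \<inter> T) \<union> (A \<inter> B))"
  proof (cases "S \<inter> T = {}")
    case True
    have "finite (A \<inter> B)" using fin by simp
    then show ?thesis
      unfolding True using assms(5) by (simp add: Suc_le_eq card_gt_0_iff)
  next
    case False
    then have "card (S \<inter> T) < card (E `` (S \<inter> T))"
      using S T by (intro surplus_graphs_card[OF assms(1)]) auto
    also have "\<dots> \<le> card (E `` (S \<inter> T) \<union> (A \<inter> B))"
      using finE fin by (intro card_mono) auto
    finally show ?thesis by simp
  qed
  moreover have "card ((E `` S \<union> A) \<union> (E `` T \<union> B)) + card (E `` (S \<inter> T) \<union> (A \<inter> B)) \<le> card (E `` S \<union> A) + card (E `` T \<union> B)"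
    using finE fin by (intro card_Un_Int_le) auto
  moreover have "(E `` S \<union> A) \<union> (E `` T \<union> B) = E `` (S \<union> T) \<union> (A \<union> B)"
    by auto
  moreover have "card (S \<union> T) + card (S \<inter> T) = card S + card T"
    using card_Un_Int[OF fin(3,4)] by simp
  ultimately have "card (E `` (S \<union> T) \<union> (A \<union> B)) \<le> Suc (card (S \<union> T))"
    using S T by simp
  then show ?thesis
    unfolding cohesive_def using S T by (intro exI[of _ "S \<union> T"]) auto
qed

text \<open>By transitivity a nonempty part of a cohesive set determines the same class, so toggling
  an element of the class changes neither the class nor its minimum.\<close>

lemma cohesion_class_eq:
  assumes "E \<in> surplus_graphs q Y" "finite Y" "B \<subseteq> B'" "B' \<subseteq> Y" "B \<noteq> {}" "cohesive q E B'"
  shows "cohesion_class q Y E B = cohesion_class q Y E B'"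
proof -
  have fin: "finite E" "finite B'"
    using assms finite_surplus_graph finite_subset by blast+
  have "cohesive q E (insert b B')" if "b \<in> Y" "cohesive q E (insert b B)" for b
  proof -
    have "cohesive q E (insert b B \<union> B')"
      using assms that by (intro cohesive_Un[OF assms(1,2)]) auto
    moreover have "insert b B \<union> B' = insert b B'"
      using assms(3) by auto
    ultimately show ?thesis by simp
  qed
  moreover have "cohesive q E (insert b B)" if "cohesive q E (insert b B')" for b
    using that by (rule cohesive_mono) (use assms(3) fin in auto)
  ultimately show ?thesis
    unfolding cohesion_class_def by blast
qed

lemma cohesion_class_superset:
  assumes "cohesive q E B" "B \<subseteq> Y"
  shows "B \<subseteq> cohesion_class q Y E B"
  using assms by (auto simp: cohesion_class_def insert_absorb)

text \<open>A larger graph or set makes cohesion harder, so classes shrink and their minima rise.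
  This is the monotonicity required of the fibre map.\<close>

lemma cohesion_class_antimono:
  assumes "E \<subseteq> E'" "finite E'" "B \<subseteq> B'" "finite B'"
  shows "cohesion_class q Y E' B' \<subseteq> cohesion_class q Y E B"
  using assms by (auto simp: cohesion_class_def intro: cohesive_mono)

section \<open>Adding one left vertex\<close>

definition join :: "nat \<Rightarrow> (nat \<times> nat) set \<Rightarrow> nat set \<Rightarrow> (nat \<times> nat) set" where
  "join q E A = E \<union> {Suc q} \<times> A"

lemma join_mono_iff:
  assumes "E \<subseteq> {1..q} \<times> Y" "E' \<subseteq> {1..q} \<times> Y'"
  shows "join q E A \<subseteq> join q E' A' \<longleftrightarrow> E \<subseteq> E' \<and> A \<subseteq> A'"
proof
  assume sub: "join q E A \<subseteq> join q E' A'"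
  show "E \<subseteq> E' \<and> A \<subseteq> A'"
  proof
    show "E \<subseteq> E'"
    proof
      fix e assume "e \<in> E"
      then have "e \<in> join q E' A'" "fst e \<noteq> Suc q"
        using sub assms(1) by (auto simp: join_def)
      then show "e \<in> E'"
        by (auto simp: join_def)
    qed
    show "A \<subseteq> A'"
    proof
      fix a assume "a \<in> A"
      then have "(Suc q, a) \<in> join q E' A'" "(Suc q, a) \<notin> E'"
        using sub assms(2) by (auto simp: join_def)
      then show "a \<in> A'"
        by (simp add: join_def)
    qed
  qed
qed (auto simp: join_def)

lemma join_eq_iff:
  assumes "E \<subseteq> {1..q} \<times> Y" "E' \<subseteq> {1..q} \<times> Y'"
  shows "join q E A = join q E' A' \<longleftrightarrow> E = E' \<and> A = A'"
  using join_mono_iff[OF assms] join_mono_iff[OF assms(2,1)] by (metis order_antisym order_refl)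

lemma insert_join: "insert (Suc q, y) (join q E A) = join q E (insert y A)"
  by (auto simp: join_def)

lemma diff_join:
  assumes "E \<subseteq> {1..q} \<times> Y"
  shows "join q E A - {(Suc q, y)} = join q E (A - {y})"
  using assms by (auto simp: join_def)

text \<open>For a left set containing the new vertex, the surplus condition is the negation of the
  inequality in \<open>cohesive\<close> for the remaining vertices; the other left sets only see
  \<open>E\<close>.\<close>

lemma surplus_graphs_Suc:
  "surplus_graphs (Suc q) Y = {join q E A | E A. E \<in> surplus_graphs q Y \<and> A \<subseteq> Y \<and> \<not> cohesive q E A}"
proof (intro set_eqI iffI)
  fix G assume G: "G \<in> surplus_graphs (Suc q) Y"
  define E A where "E = G \<inter> {1..q} \<times> Y" and "A = G `` {Suc q}"
  have GY: "G \<subseteq> {1..Suc q} \<times> Y"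
    using G by (rule surplus_graphs_subset)
  then have "G = join q E A"
    by (fastforce simp: join_def E_def A_def le_Suc_eq)
  moreover
  have im: "E `` S = G `` S" if "S \<subseteq> {1..q}" for S
    using that GY by (fastforce simp: E_def)
  then have "E \<in> surplus_graphs q Y"
  proof -
    have "card S < card (E `` S)" if "S \<subseteq> {1..q}" "S \<noteq> {}" for S
      unfolding im[OF that(1)] using that by (intro surplus_graphs_card[OF G]) auto
    moreover have "E \<subseteq> {1..q} \<times> Y"
      by (simp add: E_def)
    ultimately show ?thesis
      by (simp add: surplus_graphs_def)
  qed
  moreover have "A \<subseteq> Y"
    using GY by (auto simp: A_def)
  moreover have "\<not> cohesive q E A"
  proof
    assume "cohesive q E A"
    then obtain S where S: "S \<subseteq> {1..q}" "card (E `` S \<union> A) \<le> Suc (card S)"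
      by (auto simp: cohesive_def)
    have "Suc q \<notin> S" "finite S"
      using S(1) finite_subset by auto
    moreover have "E `` S \<union> A = G `` insert (Suc q) S"
      using im[OF S(1)] by (auto simp: A_def)
    moreover have "card (insert (Suc q) S) < card (G `` insert (Suc q) S)"
      using S(1) by (intro surplus_graphs_card[OF G]) auto
    ultimately show False
      using S(2) by simp
  qed
  ultimately show "G \<in> {join q E A | E A. E \<in> surplus_graphs q Y \<and> A \<subseteq> Y \<and> \<not> cohesive q E A}"
    by blast
next
  fix G assume "G \<in> {join q E A | E A. E \<in> surplus_graphs q Y \<and> A \<subseteq> Y \<and> \<not> cohesive q E A}"
  then obtain E A where G: "G = join q E A" and E: "E \<in> surplus_graphs q Y" and A: "A \<subseteq> Y" "\<not> cohesive q E A"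
    by blast
  have EY: "E \<subseteq> {1..q} \<times> Y"
    using E by (rule surplus_graphs_subset)
  have "card S < card (G `` S)" if S: "S \<subseteq> {1..Suc q}" "S \<noteq> {}" for S
  proof (cases "Suc q \<in> S")
    case False
    then have "S \<subseteq> {1..q}"
      using S(1) by (auto simp: le_Suc_eq subset_eq)
    moreover have "G `` S = E `` S"
      using False by (auto simp: G join_def)
    ultimately show ?thesis
      using surplus_graphs_card[OF E] S(2) by simp
  next
    case True
    then have S': "S - {Suc q} \<subseteq> {1..q}" 
      using S(1) by (auto simp: le_Suc_eq subset_eq)
    have "Suc q \<notin> Domain E"
      using EY by auto
    then have "G `` S = E `` (S - {Suc q}) \<union> A"
      using True unfolding G join_def by blast
    moreover have "Suc (card (S - {Suc q})) < card (E `` (S - {Suc q}) \<union> A)"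
      using A(2) S' unfolding cohesive_def by (metis not_le)
    moreover have "Suc (card (S - {Suc q})) = card S"
      using True finite_subset[OF S(1)] by (intro card_Suc_Diff1) auto
    ultimately show ?thesis by simp
  qed
  moreover have "G \<subseteq> {1..Suc q} \<times> Y"
    using EY A(1) by (fastforce simp: G join_def)
  ultimately show "G \<in> surplus_graphs (Suc q) Y"
    by (simp add: surplus_graphs_def)
qed

section \<open>Toggling edges at the last left vertex\<close>

definition separated_graphs :: "nat \<Rightarrow> nat set \<Rightarrow> nat \<Rightarrow> (nat \<times> nat) set set" where
  "separated_graphs q Y c = {E \<in> surplus_graphs q Y. \<forall>z\<in>Y. z < c \<longrightarrow> \<not> cohesive q E {z, c}}"

lemma surplus_graphs_mono:
  assumes "E \<in> surplus_graphs q Y" "E \<subseteq> E'" "E' \<subseteq> {1..q} \<times> Y" "finite Y"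
  shows "E' \<in> surplus_graphs q Y"
proof -
  have "finite E'"
    using assms(3) by (rule finite_subset) (simp add: assms(4))
  have "card S < card (E' `` S)" if "S \<subseteq> {1..q}" "S \<noteq> {}" for S
  proof -
    have "card S < card (E `` S)"
      using assms(1) that by (rule surplus_graphs_card)
    also have "\<dots> \<le> card (E' `` S)"
      using \<open>finite E'\<close> assms(2) by (intro card_mono finite_Image) auto
    finally show ?thesis .
  qed
  then show ?thesis
    using assms(3) by (simp add: surplus_graphs_def)
qed

text \<open>The first toggle fails only if deleting the edge to \<open>Min Y\<close> destroys the
  surplus. Then the other neighbours \<open>B\<close> of the last vertex lie in one class, which
  avoids \<open>Min Y\<close>. Toggling the edge to the least element \<open>c\<close> of this class
  fails only for \<open>B = {c}\<close>, and there \<open>c\<close> is least in its own class, which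
  is the condition in \<open>separated_graphs\<close>.\<close>

lemma matchable_surplus_graphs_Suc:
  assumes Y: "finite Y" "Y \<noteq> {}"
    and C: "\<And>c. c \<in> Y \<Longrightarrow> Min Y < c \<Longrightarrow> matchable (separated_graphs q Y c) (C c)"
  shows "matchable (surplus_graphs (Suc q) Y)
    (\<Union>c\<in>Y - {Min Y}. (\<union>) ({Suc q} \<times> {Min Y, c}) ` C c)"
proof -
  define y0 where "y0 = Min Y"
  define e where "e = (Suc q, y0)"
  let ?P = "surplus_graphs (Suc q) Y" and ?cls = "cohesion_class q Y"
  define Q where "Q = {G \<in> ?P. G - {e} \<notin> ?P}"
  define good where "good E B \<longleftrightarrow> E \<in> surplus_graphs q Y \<and> B \<subseteq> Y \<and> B \<noteq> {} \<and> cohesive q E B \<and> y0 \<notin> ?cls E B"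
    for E B
  have y0: "y0 \<in> Y" "\<And>y. y \<in> Y \<Longrightarrow> y0 \<le> y"
    using Y by (auto simp: y0_def)
  have finP: "finite ?P"
    using Y(1) by (rule finite_surplus_graphs)
  have fin_cls: "finite (?cls E B)" for E B
    using Y(1) by (simp add: cohesion_class_def)
  have goodD: "E \<in> surplus_graphs q Y" "E \<subseteq> {1..q} \<times> Y" "finite E" "B \<subseteq> Y" "finite B" "B \<noteq> {}"
      "cohesive q E B" "y0 \<notin> ?cls E B" "y0 \<notin> B" "?cls E B \<noteq> {}" "B \<subseteq> ?cls E B" if "good E B" for E B
  proof -
    show 1: "E \<in> surplus_graphs q Y" "B \<subseteq> Y" "B \<noteq> {}" "cohesive q E B" "y0 \<notin> ?cls E B"
      using that by (simp_all add: good_def)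
    show "E \<subseteq> {1..q} \<times> Y" "finite E" "finite B"
      by (rule surplus_graphs_subset[OF 1(1)], rule finite_surplus_graph[OF 1(1) Y(1)],
          rule finite_subset[OF 1(2) Y(1)])
    show "B \<subseteq> ?cls E B"
      using 1 by (intro cohesion_class_superset)
    then show "y0 \<notin> B" "?cls E B \<noteq> {}"
      using 1 by blast+
  qed
  have Q: "Q = {join q E (insert y0 B) | E B. good E B}"
  proof (intro set_eqI iffI)
    fix G assume "G \<in> Q"
    then have G: "G \<in> ?P" "G - {e} \<notin> ?P"
      by (simp_all add: Q_def)
    then obtain E A where EA: "G = join q E A" "E \<in> surplus_graphs q Y" "A \<subseteq> Y" "\<not> cohesive q E A"
      unfolding surplus_graphs_Suc by blast
    have "G - {e} = join q E (A - {y0})"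
      unfolding EA(1) e_def by (rule diff_join[OF surplus_graphs_subset[OF EA(2)]])
    then have coh: "cohesive q E (A - {y0})"
      using G(2) EA unfolding surplus_graphs_Suc by blast
    then have A: "y0 \<in> A"
      using EA(4) by (metis Diff_empty Diff_insert0)
    then have ins: "insert y0 (A - {y0}) = A"
      by auto
    \<comment> \<open>The singleton \<open>{y0}\<close> is cohesive, so a second neighbour is
      forced.\<close>
    moreover have "A - {y0} \<noteq> {}"
      using EA(4) ins cohesive_singleton by metis
    moreover have "y0 \<notin> ?cls E (A - {y0})"
      using EA(4) ins by (simp add: cohesion_class_def)
    ultimately have "good E (A - {y0})" "G = join q E (insert y0 (A - {y0}))"
      using EA coh by (auto simp: good_def)
    then show "G \<in> {join q E (insert y0 B) | E B. good E B}"
      by blast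
  next
    fix G assume "G \<in> {join q E (insert y0 B) | E B. good E B}"
    then obtain E B where G: "G = join q E (insert y0 B)" and EB: "good E B"
      by blast
    note EB' = goodD[OF EB]
    have "\<not> cohesive q E (insert y0 B)"
      using EB'(8) y0(1) by (simp add: cohesion_class_def)
    then have "G \<in> ?P"
      unfolding surplus_graphs_Suc G using EB'(1,4) y0(1) by blast
    moreover have Ge: "G - {e} = join q E B"
      unfolding G e_def diff_join[OF EB'(2)] using EB'(9) by simp
    have "G - {e} \<notin> ?P"
    proof
      assume "G - {e} \<in> ?P"
      then obtain E' A' where "join q E B = join q E' A'" "E' \<in> surplus_graphs q Y" "\<not> cohesive q E' A'"
        unfolding surplus_graphs_Suc Ge by blast
      then show False
        using join_eq_iff[OF EB'(2) surplus_graphs_subset] EB'(7) by metis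
    qed
    ultimately show "G \<in> Q"
      by (simp add: Q_def)
  qed
  have upper: "F' \<in> ?P" if "F \<in> ?P" "F \<subseteq> F'" "F' \<subseteq> {1..Suc q} \<times> Y" for F F'
    using surplus_graphs_mono that Y(1) by blast

  have "matchable (?P - Q) {}"
  proof (rule matchable_toggle[of _ e])
    show "finite (?P - Q)"
      using finP by simp
    fix F assume F: "F \<in> ?P - Q"
    then have F': "F \<in> ?P" "F - {e} \<in> ?P"
      by (simp_all add: Q_def)
    have "insert e F \<subseteq> {1..Suc q} \<times> Y"
      using surplus_graphs_subset[OF F'(1)] y0(1) by (simp add: e_def)
    then have "insert e F \<in> ?P"
      by (rule upper[OF F'(1) subset_insertI])
    then show "insert e F \<in> ?P - Q"
      using F'(2) by (simp add: Q_def)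
    show "F - {e} \<in> ?P - Q"
      using F'(2) by (simp add: Q_def)
  qed
  moreover have "matchable Q (\<Union>c\<in>Y - {y0}. (\<union>) ({Suc q} \<times> {y0, c}) ` C c)"
  proof -
    \<comment> \<open>\<open>h\<close> recovers \<open>E\<close> and \<open>B\<close> from the
      joined graph and returns the least element of the class of \<open>B\<close>.\<close>
    define h where "h G = Min (?cls {x \<in> G. fst x \<noteq> Suc q} (G `` {Suc q} - {y0}))" for G
    have h: "h (join q E (insert y0 B)) = Min (?cls E B)" if "good E B" for E B
    proof -
      have "{x \<in> join q E (insert y0 B). fst x \<noteq> Suc q} = E"
        using goodD(2)[OF that] by (auto simp: join_def)
      moreover have "join q E (insert y0 B) `` {Suc q} - {y0} = B"
        using goodD(2,9)[OF that] by (auto simp: join_def)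
      ultimately show ?thesis by (simp add: h_def)
    qed
    show ?thesis
    proof (rule matchable_fibres_index[where f = h])
      show "finite Q"
        using finP by (simp add: Q_def)
      show "h F \<le> h F'" if FQ: "F \<in> Q" "F' \<in> Q" "F \<subseteq> F'" for F F'
      proof -
        obtain E B E' B' where *: "F = join q E (insert y0 B)" "good E B"
          "F' = join q E' (insert y0 B')" "good E' B'"
          using FQ unfolding Q by blast
        have "E \<subseteq> E' \<and> insert y0 B \<subseteq> insert y0 B'"
          using join_mono_iff[OF goodD(2)[OF *(2)] goodD(2)[OF *(4)]] FQ(3) unfolding * by (rule iffD1)
        then have "?cls E' B' \<subseteq> ?cls E B"
          using goodD(9)[OF *(2)] goodD(3,5)[OF *(4)] by (intro cohesion_class_antimono) auto
        then show ?thesis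
          unfolding *(1,3) h[OF *(2)] h[OF *(4)] using goodD(10)[OF *(4)] fin_cls by (intro Min_antimono)
      qed
      show "h ` Q \<subseteq> Y - {y0}"
      proof
        fix c assume "c \<in> h ` Q"
        then obtain E B where *: "good E B" "c = Min (?cls E B)"
          using h unfolding Q by blast
        then have "c \<in> ?cls E B"
          using fin_cls goodD(10) by (auto intro: Min_in)
        then show "c \<in> Y - {y0}"
          using goodD(8)[OF *(1)] by (auto simp: cohesion_class_def)
      qed
      fix c assume c: "c \<in> Y - {y0}"
      then have "y0 < c"
        using y0(2)[of c] by auto
      \<comment> \<open>\<open>R\<close> is the part of the fibre with \<open>B = {c}\<close>, where
        removing \<open>c\<close> would empty \<open>B\<close>; \<open>T\<close> is the part on
        which the toggle works.\<close>
      define R where "R = (\<union>) ({Suc q} \<times> {y0, c}) ` separated_graphs q Y c"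
      define T where "T = {join q E (insert y0 B) | E B. good E B \<and> Min (?cls E B) = c \<and> B \<noteq> {c}}"
      have TI: "join q E (insert y0 B) \<in> T" if "good E B" "Min (?cls E B) = c" "B \<noteq> {c}" for E B
        unfolding T_def using that by auto
      \<comment> \<open>No smaller right vertex is cohesive with \<open>c\<close> exactly when
        \<open>c\<close> is least in its class; since \<open>y0 < c\<close>, this also keeps
        \<open>y0\<close> out of the class.\<close>
      have sep: "E \<in> separated_graphs q Y c \<longleftrightarrow> good E {c} \<and> Min (?cls E {c}) = c" for E
      proof
        assume E: "E \<in> separated_graphs q Y c"
        then have E': "E \<in> surplus_graphs q Y" "\<And>z. z \<in> Y \<Longrightarrow> z < c \<Longrightarrow> \<not> cohesive q E {z, c}"
          by (auto simp: separated_graphs_def)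
        then have "good E {c}"
          using c \<open>y0 < c\<close> y0(1) by (auto simp: good_def cohesive_singleton cohesion_class_def)
        moreover have "Min (?cls E {c}) = c"
          using E'(2) c by (intro Min_eqI fin_cls) (auto simp: cohesion_class_def cohesive_singleton not_le[symmetric])
        ultimately show "good E {c} \<and> Min (?cls E {c}) = c" ..
      next
        assume E: "good E {c} \<and> Min (?cls E {c}) = c"
        have "\<not> cohesive q E {z, c}" if z: "z \<in> Y" "z < c" for z
        proof
          assume "cohesive q E {z, c}"
          then have "z \<in> ?cls E {c}"
            using z by (simp add: cohesion_class_def)
          then have "c \<le> z"
            using E Min_le[OF fin_cls, of z E "{c}"] by simp
          then show False
            using z by simp
        qed
        then show "E \<in> separated_graphs q Y c"
          using E by (simp add: separated_graphs_def good_def)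
      qed
      have R: "R = {join q E (insert y0 B) | E B. good E B \<and> Min (?cls E B) = c \<and> B = {c}}"
      proof -
        have *: "(\<union>) ({Suc q} \<times> {y0, c}) = (\<lambda>E. join q E {y0, c})"
          by (simp add: fun_eq_iff join_def Un_commute)
        have **: "separated_graphs q Y c = {E. good E {c} \<and> Min (?cls E {c}) = c}"
          using sep by (simp only: set_eq_iff mem_Collect_eq) simp
        have "R = {join q E {y0, c} | E. good E {c} \<and> Min (?cls E {c}) = c}"
          unfolding R_def * ** by (simp only: setcompr_eq_image)
        then show ?thesis
          by simp
      qed
      have "{F \<in> Q. h F = c} = R \<union> T"
      proof (intro set_eqI iffI)
        fix F assume "F \<in> {F \<in> Q. h F = c}"
        then obtain E B where F: "F = join q E (insert y0 B)" "good E B" and "h F = c"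
          unfolding Q by auto
        then have "Min (?cls E B) = c"
          using h by simp
        then show "F \<in> R \<union> T"
          unfolding R T_def using F by auto
      next
        fix F assume "F \<in> R \<union> T"
        then obtain E B where F: "F = join q E (insert y0 B)" "good E B" "Min (?cls E B) = c"
          unfolding R T_def by auto
        then have "h F = c"
          using h by simp
        moreover have "F \<in> Q"
          unfolding Q using F by auto
        ultimately show "F \<in> {F \<in> Q. h F = c}"
          by simp
      qed
      moreover have "matchable R ((\<union>) ({Suc q} \<times> {y0, c}) ` C c)"
        unfolding R_def
      proof (rule matchable_image_Un)
        show "matchable (separated_graphs q Y c) (C c)"
          using C c \<open>y0 < c\<close> by (simp add: y0_def)
        show "F \<inter> {Suc q} \<times> {y0, c} = {}" if "F \<in> separated_graphs q Y c" for F
          using goodD(2)[of F "{c}"] that sep by auto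
      qed
      moreover have "matchable T {}"
      proof (rule matchable_toggle[of _ "(Suc q, c)"])
        have "T \<subseteq> Q"
          unfolding T_def Q by blast
        then show "finite T"
          using finP by (auto simp: Q_def intro: finite_subset)
        fix F assume "F \<in> T"
        then obtain E B where F: "F = join q E (insert y0 B)" and EB: "good E B" "Min (?cls E B) = c" "B \<noteq> {c}"
          unfolding T_def by blast
        note EB' = goodD[OF EB(1)]
        have "c \<in> ?cls E B"
          using EB'(10) EB(2) fin_cls by (metis Min_in)
        then have coh: "cohesive q E (insert c B)"
          by (simp add: cohesion_class_def)
        have cls: "?cls E (insert c B) = ?cls E B"
          using EB' coh c Y(1) by (intro cohesion_class_eq[symmetric]) auto
        have "good E (insert c B)"
          using EB' coh c by (simp add: good_def cls)
        moreover have "insert c B \<noteq> {c}"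
          using EB(3) EB'(6) by auto
        ultimately have "join q E (insert y0 (insert c B)) \<in> T"
          using EB(2) cls by (intro TI) simp_all
        then show "insert (Suc q, c) F \<in> T"
          unfolding F insert_join by (simp add: insert_commute)
        \<comment> \<open>Excluding \<open>B = {c}\<close> keeps the toggle from producing an empty
          \<open>B\<close>.\<close>
        have ne: "B - {c} \<noteq> {}"
          using EB(3) EB'(6) by auto
        have cls': "?cls E (B - {c}) = ?cls E B"
          using EB' ne Y(1) by (intro cohesion_class_eq) auto
        have "cohesive q E (B - {c})"
          using EB'(7) by (rule cohesive_mono) (use EB' in auto)
        then have "good E (B - {c})"
          using EB' ne by (auto simp: good_def cls')
        moreover have "B - {c} \<noteq> {c}"
          by auto
        ultimately have "join q E (insert y0 (B - {c})) \<in> T"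
          using EB(2) cls' by (intro TI) simp_all
        moreover have "insert y0 B - {c} = insert y0 (B - {c})"
          using c by auto
        ultimately show "F - {(Suc q, c)} \<in> T"
          unfolding F diff_join[OF EB'(2)] by simp
      qed
      \<comment> \<open>A member of \<open>T\<close> below one of \<open>R\<close> would have a
        nonempty \<open>B'\<close> inside \<open>{c}\<close>. Hence \<open>R\<close> is the lower
        family.\<close>
      moreover have "\<not> F' \<subseteq> F" if F: "F \<in> R" "F' \<in> T" for F F'
      proof
        assume "F' \<subseteq> F"
        obtain E where E: "F = join q E (insert y0 {c})" "good E {c}"
          using F(1) unfolding R by auto
        obtain E' B' where E': "F' = join q E' (insert y0 B')" "good E' B'" "B' \<noteq> {c}"
          using F(2) unfolding T_def by auto
        have "E' \<subseteq> E \<and> insert y0 B' \<subseteq> {y0, c}"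
          using join_mono_iff[OF goodD(2)[OF E'(2)] goodD(2)[OF E(2)]] \<open>F' \<subseteq> F\<close> unfolding E(1) E'(1)
          by (rule iffD1)
        then have "B' \<subseteq> {c}"
          using goodD(9)[OF E'(2)] by auto
        then show False
          using goodD(6)[OF E'(2)] E'(3) by auto
      qed
      ultimately have "matchable (R \<union> T) ((\<union>) ({Suc q} \<times> {y0, c}) ` C c \<union> {})"
        by (intro matchable.union)
      then show "matchable {F \<in> Q. h F = c} ((\<union>) ({Suc q} \<times> {y0, c}) ` C c)"
        using \<open>{F \<in> Q. h F = c} = R \<union> T\<close> by simp
    qed
  qed
  \<comment> \<open>Surviving the deletion of \<open>e\<close> passes to larger graphs, so
    \<open>Q\<close> is the lower family.\<close>
  moreover have "\<not> F' \<subseteq> F" if F: "F \<in> Q" "F' \<in> ?P - Q" for F F'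
  proof
    assume "F' \<subseteq> F"
    have "F' - {e} \<in> ?P" "F - {e} \<notin> ?P" "F \<in> ?P"
      using F by (simp_all add: Q_def)
    moreover have "F' - {e} \<subseteq> F - {e}"
      using \<open>F' \<subseteq> F\<close> by blast
    moreover have "F - {e} \<subseteq> {1..Suc q} \<times> Y"
      using surplus_graphs_subset[OF \<open>F \<in> ?P\<close>] by blast
    ultimately show False
      using upper[of "F' - {e}" "F - {e}"] by simp
  qed
  ultimately have "matchable (Q \<union> (?P - Q)) ((\<Union>c\<in>Y - {y0}. (\<union>) ({Suc q} \<times> {y0, c}) ` C c) \<union> {})"
    by (intro matchable.union)
  moreover have "Q \<union> (?P - Q) = ?P"
    by (auto simp: Q_def)
  ultimately show ?thesis
    by (simp add: y0_def)
qed

text \<open>As \<open>c\<close> is least in its class and not least in \<open>Y\<close>, Hall's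
  condition persists without \<open>c\<close>. If the whole left side is not tight, an edge
  \<open>(i, c)\<close> with \<open>i\<close> outside all tight sets is irrelevant to the surplus.
  If it is tight, its neighbours other than \<open>c\<close> form a \<open>q\<close>-set
  \<open>W\<close> above \<open>c\<close>, and the fibre over \<open>W\<close> is a full family of
  surplus graphs on \<open>insert c W\<close>.\<close>

lemma matchable_separated_graphs:
  assumes Y: "finite Y" "y0 \<in> Y" "y0 < c" "c \<in> Y"
    and C: "\<And>W. W \<subseteq> {y \<in> Y. c < y} \<Longrightarrow> card W = q \<Longrightarrow> matchable (surplus_graphs q (insert c W)) (C W)"
  shows "matchable (separated_graphs q Y c) (\<Union>W\<in>{W. W \<subseteq> {y \<in> Y. c < y} \<and> card W = q}. C W)"
proof -
  let ?X = "{1..q}" and ?P = "separated_graphs q Y c"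
  define N where "N E S = E `` S - {c}" for E :: "(nat \<times> nat) set" and S
  have finN: "finite (N E S)" if "finite E" for E S
    using that by (simp add: N_def finite_Image)
  have sep: "E \<in> ?P \<longleftrightarrow> E \<in> surplus_graphs q Y \<and> (\<forall>z\<in>Y. z < c \<longrightarrow> (\<forall>S\<subseteq>?X. card S < card (insert z (N E S))))" for E
  proof -
    have "cohesive q E {z, c} \<longleftrightarrow> \<not> (\<forall>S\<subseteq>?X. card S < card (insert z (N E S)))"
      if "E \<in> surplus_graphs q Y" "z < c" for z
    proof -
      have "card (E `` S \<union> {z, c}) = Suc (card (insert z (N E S)))" for S
      proof -
        have "E `` S \<union> {z, c} = insert c (insert z (N E S))" "c \<notin> insert z (N E S)"
          using that(2) by (auto simp: N_def)
        then show ?thesis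
          using finN[OF finite_surplus_graph[OF that(1) Y(1)]] by simp
      qed
      then show ?thesis
        unfolding cohesive_def by (simp add: not_less)
    qed
    then show ?thesis
      unfolding separated_graphs_def by blast
  qed
  have finP: "finite ?P"
    by (rule finite_subset[OF _ finite_surplus_graphs[OF Y(1)]]) (auto simp: sep)
  have PD: "finite E" "E \<subseteq> ?X \<times> Y" if "E \<in> ?P" for E
    using that finite_surplus_graph Y(1) surplus_graphs_subset by (auto simp: sep)
  have hall: "card S \<le> card (N E S)" if "E \<in> ?P" "S \<subseteq> ?X" for E S
  proof -
    \<comment> \<open>The vertex \<open>y0\<close> below \<open>c\<close> plays the role of
      \<open>z\<close>; inserting it gains at most one, so the strict inequality becomes Hall's
      condition without \<open>c\<close>.\<close>
    have "card S < card (insert y0 (N E S))"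
      using that Y by (simp add: sep)
    also have "\<dots> \<le> Suc (card (N E S))"
      using finN PD(1)[OF that(1)] by (simp add: card_insert_if)
    finally show ?thesis by simp
  qed
  define Tight where "Tight = {E \<in> ?P. card (N E ?X) = q}"

  have "matchable (?P - Tight) {}"
  proof -
    \<comment> \<open>Fixing the edges away from \<open>c\<close> fixes the tight sets, so one
      \<open>i\<close> serves the whole fibre.\<close>
    define f where "f E = {e \<in> E. snd e \<noteq> c}" for E :: "(nat \<times> nat) set"
    have Nf: "N (f E) S = N E S" for E S
      by (auto simp: N_def f_def)
    have "matchable {F \<in> ?P - Tight. f F = G} {}" if G: "G \<in> f ` (?P - Tight)" for G
    proof -
      obtain E where "E \<in> ?P - Tight" "G = f E"
        using G by (elim imageE)
      then have E: "E \<in> ?P" "E \<notin> Tight" "G = f E"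
        by simp_all
      have "\<exists>i\<in>?X. \<forall>S\<subseteq>?X. card (N G S) = card S \<longrightarrow> i \<notin> S"
      proof -
        define \<T> where "\<T> = {S. S \<subseteq> ?X \<and> card (N G S) = card S}"
        have "finite \<T>"
          by (rule finite_subset[of _ "Pow ?X"]) (auto simp: \<T>_def)
        \<comment> \<open>Submodularity together with Hall's condition for union and intersection
          forces equality throughout.\<close>
        have Un: "S \<union> S' \<in> \<T>" if SS: "S \<in> \<T>" "S' \<in> \<T>" for S S'
        proof -
          have fin: "finite S" "finite S'" and X: "S \<subseteq> ?X" "S' \<subseteq> ?X"
            using SS finite_subset by (auto simp: \<T>_def)
          have "card (N E S \<union> N E S') + card (N E (S \<inter> S')) \<le> card (N E S) + card (N E S')"
            using finN PD(1)[OF E(1)] by (intro card_Un_Int_le) (auto simp: N_def)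
          moreover have "N E S \<union> N E S' = N E (S \<union> S')"
            by (auto simp: N_def)
          moreover have "card (S \<inter> S') \<le> card (N E (S \<inter> S'))" "card (S \<union> S') \<le> card (N E (S \<union> S'))"
            using X by (auto intro!: hall[OF E(1)])
          moreover have "card (S \<union> S') + card (S \<inter> S') = card S + card S'"
            using card_Un_Int[OF fin] by simp
          ultimately show ?thesis
            using SS by (simp add: \<T>_def E(3) Nf)
        qed
        have "\<Union>\<F> \<in> \<T>" if "finite \<F>" "\<F> \<subseteq> \<T>" for \<F>
          using that
        proof (induction \<F>)
          case empty
          show ?case by (simp add: \<T>_def N_def)
        qed (use Un in auto)
        then have "\<Union>\<T> \<in> \<T>"
          using \<open>finite \<T>\<close> by blast
        moreover have "?X \<notin> \<T>"
          using E by (simp add: \<T>_def Tight_def Nf)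
        ultimately have "\<Union>\<T> \<subset> ?X"
          by (metis (no_types, lifting) \<T>_def mem_Collect_eq psubsetI)
        then show ?thesis
          unfolding \<T>_def by blast
      qed
      then obtain i where i: "i \<in> ?X" "\<And>S. S \<subseteq> ?X \<Longrightarrow> card (N G S) = card S \<Longrightarrow> i \<notin> S"
        by blast
      have key: "F' \<in> {F \<in> ?P - Tight. f F = G}"
        if F: "F \<in> {F \<in> ?P - Tight. f F = G}" and F': "F' - {(i, c)} = F - {(i, c)}" for F F'
      proof -
        have "f H = f (H - {(i, c)})" for H
          by (auto simp: f_def)
        then have fF: "f F' = f F"
          using F' by metis
        have "f F = G"
          using F by simp
        then have NF: "N F' S = N F S" "N F' S = N G S" for S
          using Nf[of F S] Nf[of F' S] fF by simp_all
        have FP: "F \<in> ?P" "F \<notin> Tight"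
          using F by auto
        have sub: "F' \<subseteq> ?X \<times> Y"
        proof -
          have "F' \<subseteq> insert (i, c) F"
            using F' by blast
          then show ?thesis
            using PD(2)[OF FP(1)] i(1) Y(4) by blast
        qed
        then have fin: "finite F'"
          using Y(1) by (auto intro: finite_subset)
        \<comment> \<open>A tight \<open>S\<close> does not contain \<open>i\<close>, so its
          neighbourhood is unchanged; any other \<open>S\<close> has enough neighbours without
          \<open>c\<close>.\<close>
        have "card S < card (F' `` S)" if S: "S \<subseteq> ?X" "S \<noteq> {}" for S
        proof (cases "card (N G S) = card S")
          case True
          then have "i \<notin> S"
            using i(2) S by blast
          then have "H `` S = (H - {(i, c)}) `` S" for H
            by blast
          then have "F' `` S = F `` S"
            using F' by metis
          moreover have "F \<in> surplus_graphs q Y"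
            using FP(1) by (simp add: sep)
          ultimately show ?thesis
            using surplus_graphs_card[OF _ S, of F Y] by simp
        next
          case False
          then have "card S < card (N F' S)"
            using hall[OF FP(1) S(1)] NF by (metis le_neq_implies_less)
          also have "\<dots> \<le> card (F' `` S)"
            using fin by (intro card_mono finite_Image) (auto simp: N_def)
          finally show ?thesis .
        qed
        then have "F' \<in> surplus_graphs q Y"
          using sub by (simp add: surplus_graphs_def)
        then show ?thesis
          using F fF NF(1) by (simp add: sep Tight_def)
      qed
      show ?thesis
        by (rule matchable_toggle[of _ "(i, c)"]) (use finP in simp, (rule key, assumption, blast)+)
    qed
    then have "matchable (?P - Tight) (\<Union>G\<in>f ` (?P - Tight). {})"
      by (intro matchable_fibres) (use finP in \<open>auto simp: f_def\<close>)
    then show ?thesis by simp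
  qed
  moreover have "matchable Tight (\<Union>W\<in>{W. W \<subseteq> {y \<in> Y. c < y} \<and> card W = q}. C W)"
  proof (rule matchable_fibres_index[where f = "\<lambda>E. N E ?X"])
    show "finite Tight"
      using finP by (simp add: Tight_def)
    show "N F ?X \<subseteq> N F' ?X" if "F \<subseteq> F'" for F F'
      using that by (auto simp: N_def)
    show "(\<lambda>E. N E ?X) ` Tight \<subseteq> {W. W \<subseteq> {y \<in> Y. c < y} \<and> card W = q}"
    proof (rule image_subsetI, intro CollectI conjI subsetI)
      fix E y assume E: "E \<in> Tight"
      then have EP: "E \<in> ?P" and card: "card (N E ?X) = q"
        by (simp_all add: Tight_def)
      show "card (N E ?X) = q" by (rule card)
      assume y: "y \<in> N E ?X"
      then have "y \<in> Y" "y \<noteq> c"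
        using PD(2)[OF EP] by (auto simp: N_def)
      \<comment> \<open>A neighbour \<open>y\<close> below \<open>c\<close> could be taken as
        \<open>z\<close> without enlarging the neighbourhood, against tightness.\<close>
      moreover have "\<not> y < c"
      proof
        assume "y < c"
        then have "card ?X < card (insert y (N E ?X))"
          using EP \<open>y \<in> Y\<close> unfolding sep by blast
        then show False
          using y card by (simp add: insert_absorb)
      qed
      ultimately show "y \<in> Y" "c < y"
        by auto
    qed
    fix W assume "W \<in> {W. W \<subseteq> {y \<in> Y. c < y} \<and> card W = q}"
    then have W: "W \<subseteq> {y \<in> Y. c < y}" "card W = q" and WY: "W \<subseteq> Y" "c \<notin> W"
      by auto
    then have finW: "finite W"
      using Y(1) finite_subset by blast
    have "{E \<in> Tight. N E ?X = W} = surplus_graphs q (insert c W)"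
    proof (intro set_eqI iffI)
      fix E assume "E \<in> {E \<in> Tight. N E ?X = W}"
      then have E: "E \<in> ?P" "N E ?X = W"
        by (simp_all add: Tight_def)
      have "E \<subseteq> ?X \<times> insert c W"
      proof
        fix e assume "e \<in> E"
        then have "fst e \<in> ?X" "snd e \<in> E `` ?X"
          using PD(2)[OF E(1)] by force+
        then show "e \<in> ?X \<times> insert c W"
          using E(2) by (cases e) (auto simp: N_def)
      qed
      then show "E \<in> surplus_graphs q (insert c W)"
        using E(1) by (simp add: sep surplus_graphs_def)
    next
      fix E assume E: "E \<in> surplus_graphs q (insert c W)"
      then have sub: "E \<subseteq> ?X \<times> insert c W"
        by (rule surplus_graphs_subset)
      have finE: "finite E"
        using finite_surplus_graph[OF E] finW by simp
      have "E \<subseteq> ?X \<times> Y"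
        using sub WY(1) Y(4) by blast
      then have "E \<in> surplus_graphs q Y"
        using E by (simp add: surplus_graphs_def)
      moreover have "card S < card (insert z (N E S))" if z: "z < c" and S: "S \<subseteq> ?X" for z S
      proof (cases "S = {}")
        case False
        have "card S < card (E `` S)"
          using E S False by (rule surplus_graphs_card)
        also have "\<dots> \<le> card (insert c (N E S))"
          using finN[OF finE] by (intro card_mono) (auto simp: N_def)
        also have "\<dots> = Suc (card (N E S))"
          by (rule card_insert_disjoint[OF finN[OF finE]]) (simp add: N_def)
        \<comment> \<open>All neighbours are \<open>c\<close> or above it, so \<open>z\<close> is
          new and makes up for the deleted \<open>c\<close>.\<close>
        also have "z \<notin> N E S"
          using sub W(1) z by (auto simp: N_def)
        then have "Suc (card (N E S)) = card (insert z (N E S))"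
          using finN[OF finE] by simp
        finally show ?thesis .
      qed (simp add: N_def)
      ultimately have "E \<in> ?P"
        by (simp add: sep)
      moreover have "N E ?X = W"
      proof (rule card_subset_eq[OF finW])
        show "N E ?X \<subseteq> W"
          using sub by (auto simp: N_def)
        then have "card (N E ?X) \<le> q"
          using W(2) finW card_mono by metis
        then show "card (N E ?X) = card W"
          using hall[OF \<open>E \<in> ?P\<close>, of ?X] W(2) by simp
      qed
      ultimately show "E \<in> {E \<in> Tight. N E ?X = W}"
        using W(2) by (simp add: Tight_def)
    qed
    then show "matchable {E \<in> Tight. N E ?X = W} (C W)"
      using C[OF W] by simp
  qed
  \<comment> \<open>Hall's condition bounds the neighbourhood below by \<open>q\<close>, so a
    separated subgraph of a tight graph is tight, and \<open>Tight\<close> is the lower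
    family.\<close>
  moreover have "\<not> F' \<subseteq> F" if F: "F \<in> Tight" "F' \<in> ?P - Tight" for F F'
  proof
    assume "F' \<subseteq> F"
    have "F \<in> ?P" "card (N F ?X) = q"
      using F(1) by (simp_all add: Tight_def)
    have "card (N F' ?X) \<le> card (N F ?X)"
      using finN PD(1)[OF \<open>F \<in> ?P\<close>] \<open>F' \<subseteq> F\<close> by (intro card_mono) (auto simp: N_def)
    moreover have "card ?X \<le> card (N F' ?X)"
      using F(2) by (intro hall) auto
    ultimately show False
      using F by (simp add: Tight_def)
  qed
  ultimately have "matchable (Tight \<union> (?P - Tight)) ((\<Union>W\<in>{W. W \<subseteq> {y \<in> Y. c < y} \<and> card W = q}. C W) \<union> {})"
    by (intro matchable.union)
  moreover have "Tight \<union> (?P - Tight) = ?P"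
    by (auto simp: Tight_def)
  ultimately show ?thesis
    by simp
qed

text \<open>If \<open>V\<close> has elements \<open>v1 < ... < vq\<close>, this is the path
  \<open>y, q, v1, q - 1, v2, ..., 1, vq\<close>, alternating between right and left
  vertices.\<close>

fun critical_tree :: "nat \<Rightarrow> nat \<Rightarrow> nat set \<Rightarrow> (nat \<times> nat) set" where
  "critical_tree 0 y V = {}"
| "critical_tree (Suc q) y V = {Suc q} \<times> {y, Min V} \<union> critical_tree q (Min V) (V - {Min V})"

theorem matchable_surplus_graphs:
  assumes "finite Y" "Y \<noteq> {}"
  shows "matchable (surplus_graphs q Y) (critical_tree q (Min Y) ` {V. V \<subseteq> Y - {Min Y} \<and> card V = q})"
  using assms
proof (induction q arbitrary: Y)
  case 0
  have "V = {}" if "V \<subseteq> Y - {Min Y}" "card V = 0" for V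
  proof -
    have "finite V"
      using finite_subset[OF that(1)] 0(1) by simp
    then show ?thesis
      using that(2) by simp
  qed
  then have "V \<subseteq> Y - {Min Y} \<and> card V = 0 \<longleftrightarrow> V = {}" for V
    by (metis card.empty empty_subsetI)
  then have "{V. V \<subseteq> Y - {Min Y} \<and> card V = 0} = {{}}"
    by (simp only: singleton_conv)
  moreover have "surplus_graphs 0 Y = {{}}"
    by (auto simp: surplus_graphs_def subset_empty)
  ultimately show ?case
    using matchable.critical[of "{}"] by simp
next
  case (Suc q)
  define y0 where "y0 = Min Y"
  have y0: "y0 \<in> Y"
    using Suc.prems by (simp add: y0_def)
  let ?I = "\<lambda>c. {W. W \<subseteq> {y \<in> Y. c < y} \<and> card W = q}"
  \<comment> \<open>\<open>insert c W\<close> has only \<open>q + 1\<close> elements, so a single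
    choice of \<open>V\<close> is left and the induction hypothesis yields one critical
    graph.\<close>
  have IH: "matchable (surplus_graphs q (insert c W)) {critical_tree q c W}"
    if W: "W \<subseteq> {y \<in> Y. c < y}" "card W = q" for c W
  proof -
    have fin: "finite W"
      using W(1) Suc.prems(1) finite_subset by fastforce
    have "Min (insert c W) = c"
      using W(1) fin by (intro Min_eqI) auto
    moreover have "insert c W - {c} = W"
      using W(1) by auto
    moreover have "{V. V \<subseteq> W \<and> card V = q} = {W}"
      using W(2) card_subset_eq[OF fin] by auto
    ultimately show ?thesis
      using Suc.IH[of "insert c W"] fin by simp
  qed
  have "matchable (separated_graphs q Y c) (\<Union>W\<in>?I c. {critical_tree q c W})" if "c \<in> Y" "Min Y < c" for c
    using Suc.prems(1) y0 that IH unfolding y0_def[symmetric] by (intro matchable_separated_graphs)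
  then have "matchable (surplus_graphs (Suc q) Y)
      (\<Union>c\<in>Y - {Min Y}. (\<union>) ({Suc q} \<times> {Min Y, c}) ` (\<Union>W\<in>?I c. {critical_tree q c W}))"
    by (rule matchable_surplus_graphs_Suc[OF Suc.prems])
  moreover have "(\<Union>c\<in>Y - {Min Y}. (\<union>) ({Suc q} \<times> {Min Y, c}) ` (\<Union>W\<in>?I c. {critical_tree q c W})) =
      critical_tree (Suc q) (Min Y) ` {V. V \<subseteq> Y - {Min Y} \<and> card V = Suc q}" (is "?L = ?R")
  proof (intro set_eqI iffI)
    fix F assume "F \<in> ?L"
    then obtain c W where c: "c \<in> Y" "c \<noteq> Min Y" and W: "W \<subseteq> {y \<in> Y. c < y}" "card W = q"
      and F: "F = {Suc q} \<times> {Min Y, c} \<union> critical_tree q c W"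
      by auto
    have fin: "finite W"
      using W(1) Suc.prems(1) finite_subset by fastforce
    have m: "Min (insert c W) = c"
      using W(1) fin by (intro Min_eqI) auto
    have cW: "c \<notin> W" "insert c W - {c} = W"
      using W(1) by auto
    have "F = critical_tree (Suc q) (Min Y) (insert c W)"
      by (simp only: F critical_tree.simps m cW(2))
    moreover have "insert c W \<subseteq> Y - {Min Y}"
    proof -
      have "Min Y < c"
        using c Suc.prems(1) by (metis Min_le order_le_imp_less_or_eq)
      then show ?thesis
        using c W(1) by auto
    qed
    moreover have "card (insert c W) = Suc q"
      using fin cW(1) W(2) by simp
    ultimately show "F \<in> ?R"
      by blast
  next
    fix F assume "F \<in> ?R"
    then obtain V where V: "V \<subseteq> Y - {Min Y}" "card V = Suc q" and F: "F = critical_tree (Suc q) (Min Y) V"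
      by blast
    have fin: "finite V" "V \<noteq> {}"
      using V Suc.prems(1) finite_subset by fastforce+
    then have m: "Min V \<in> V" "\<And>v. v \<in> V \<Longrightarrow> Min V \<le> v"
      by auto
    then have "V - {Min V} \<in> ?I (Min V)"
      using V fin by (force simp: order_less_le)
    moreover have "Min V \<in> Y - {Min Y}"
      using V(1) m(1) by blast
    ultimately show "F \<in> ?L"
      unfolding F by (auto simp only: critical_tree.simps intro!: UN_I imageI)
  qed
  ultimately show ?case
    by simp
qed

lemma critical_tree_subset: "critical_tree q y V \<subseteq> {1..q} \<times> UNIV"
  by (induction q y V rule: critical_tree.induct) fastforce+

lemma card_critical_tree:
  "finite V \<Longrightarrow> card V = q \<Longrightarrow> y \<notin> V \<Longrightarrow> card (critical_tree q y V) = 2 * q \<and> finite (critical_tree q y V)"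
proof (induction q y V rule: critical_tree.induct)
  case (2 q y V)
  let ?T = "critical_tree q (Min V) (V - {Min V})"
  have "Min V \<in> V"
    using 2 by (intro Min_in) auto
  then have "card ?T = 2 * q \<and> finite ?T" and ne: "y \<noteq> Min V"
    using 2 by auto
  moreover have "({Suc q} \<times> {y, Min V}) \<inter> ?T = {}"
    using critical_tree_subset[of q "Min V" "V - {Min V}"] by auto
  moreover have "card ({Suc q} \<times> {y, Min V}) = 2"
    using ne by (simp add: card_cartesian_product)
  ultimately show ?case
    by (simp add: card_Un_disjoint)
qed simp

text \<open>Recovers \<open>V\<close> from its path. Inserting \<open>y\<close> on both sides covers
  \<open>q = 0\<close>, where the path has no edge.\<close>

lemma right_vertices_critical_tree:
  "finite V \<Longrightarrow> card V = q \<Longrightarrow> insert y (snd ` critical_tree q y V) = insert y V"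
proof (induction q y V rule: critical_tree.induct)
  case (2 q y V)
  have "Min V \<in> V"
    using 2 by (intro Min_in) auto
  then have "insert (Min V) (snd ` critical_tree q (Min V) (V - {Min V})) = V"
    using 2 by (simp add: insert_absorb)
  then show ?case
    by (auto simp: image_Un)
qed simp

lemma inj_on_critical_tree:
  assumes "finite A" "y \<notin> A"
  shows "inj_on (critical_tree q y) {V. V \<subseteq> A \<and> card V = q}"
proof (rule inj_onI)
  fix V V' assume V: "V \<in> {V. V \<subseteq> A \<and> card V = q}" "V' \<in> {V. V \<subseteq> A \<and> card V = q}"
    and eq: "critical_tree q y V = critical_tree q y V'"
  then have "insert y V = insert y V'" "y \<notin> V" "y \<notin> V'"
    using right_vertices_critical_tree[of V q y] right_vertices_critical_tree[of V' q y] assms finite_subset by auto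
  then show "V = V'"
    by (simp add: insert_ident)
qed

lemma ex_matchable_not_NBFC:
  assumes "q < s"
  shows "\<exists>C. matchable (full_simplex q s - NBFC q s) C \<and> card C = (s - 1) choose q \<and> (\<forall>c\<in>C. card c = 2 * q)"
proof -
  let ?Y = "{1..s}" and ?V = "{V. V \<subseteq> {1..s} - {1} \<and> card V = q}"
  have "full_simplex q s - NBFC q s = {E. E \<subseteq> {1..q} \<times> {1..s} \<and> E \<in> surplus_graphs q ?Y}"
    unfolding full_simplex_def NBFC_def factor_critical_iff_surplus[OF assms] by blast
  also have "\<dots> = surplus_graphs q ?Y"
    using surplus_graphs_subset by blast
  finally have eq: "full_simplex q s - NBFC q s = surplus_graphs q ?Y" .
  have min: "Min ?Y = 1"
    using assms by (intro Min_eqI) auto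
  have "matchable (surplus_graphs q ?Y) (critical_tree q 1 ` ?V)"
    using matchable_surplus_graphs[of ?Y q] assms unfolding min by simp
  moreover have "card (critical_tree q 1 ` ?V) = (s - 1) choose q"
  proof -
    have "card (critical_tree q 1 ` ?V) = card ?V"
      by (intro card_image inj_on_critical_tree) auto
    also have "\<dots> = card ({1..s} - {1}) choose q"
      by (rule n_subsets) simp
    also have "card ({1..s} - {1}) = s - 1"
      using assms by (subst card_Diff_singleton) auto
    finally show ?thesis .
  qed
  moreover have "card c = 2 * q" if c: "c \<in> critical_tree q 1 ` ?V" for c
  proof -
    obtain V where V: "c = critical_tree q 1 V" "V \<subseteq> {1..s} - {1}" "card V = q"
      using c by blast
    then have "finite V" "1 \<notin> V"
      using finite_subset by blast+
    then show ?thesis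
      using V card_critical_tree by blast
  qed
  ultimately show ?thesis
    unfolding eq by blast
qed

section \<open>Homotopy invariance of collapsing\<close>

abbreviation collapse_map :: "'a set \<Rightarrow> 'a \<Rightarrow> 'a option" where
  "collapse_map A x \<equiv> if x \<in> A then None else Some x"

definition induced_map :: "'b set \<Rightarrow> ('a \<Rightarrow> 'b) \<Rightarrow> 'a option \<Rightarrow> 'b option" where
  "induced_map B g p = (case p of None \<Rightarrow> None | Some x \<Rightarrow> collapse_map B (g x))"

lemma quotient_map_collapse: "quotient_map X (collapse X A) (collapse_map A)"
  unfolding collapse_def by (rule quotient_map_quotient_topology)

lemma continuous_map_collapse_map: "continuous_map X (collapse X A) (collapse_map A)"
  by (rule quotient_imp_continuous_map[OF quotient_map_collapse])

lemma topspace_collapse: "topspace (collapse X A) = collapse_map A ` topspace X"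
  by (simp add: collapse_def)

lemma continuous_map_induced_map:
  assumes "continuous_map X Y g" "\<And>x. x \<in> topspace X \<Longrightarrow> x \<in> A \<Longrightarrow> g x \<in> B"
  shows "continuous_map (collapse X A) (collapse Y B) (induced_map B g)"
proof (rule continuous_compose_quotient_map[OF quotient_map_collapse])
  have "continuous_map X (collapse Y B) (collapse_map B \<circ> g)"
    by (rule continuous_map_compose[OF assms(1) continuous_map_collapse_map])
  then show "continuous_map X (collapse Y B) (induced_map B g \<circ> collapse_map A)"
    by (rule continuous_map_eq) (use assms(2) in \<open>simp add: induced_map_def\<close>)
qed

text \<open>The point is continuity on the interval times the quotient: the product of a quotient
  map with the identity of a locally compact Hausdorff space is again a quotient map.\<close>

lemma homotopic_induced_maps:
  assumes h: "continuous_map (prod_topology (top_of_set {0..1::real}) X) Y h"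
    and A: "\<And>t x. t \<in> {0..1} \<Longrightarrow> x \<in> topspace X \<Longrightarrow> x \<in> A \<Longrightarrow> h (t, x) \<in> B"
  shows "homotopic_with (\<lambda>x. True) (collapse X A) (collapse Y B)
    (induced_map B (\<lambda>x. h (0, x))) (induced_map B (\<lambda>x. h (1, x)))"
proof -
  let ?I = "top_of_set {0..1::real}"
  have q: "quotient_map (prod_topology ?I X) (prod_topology ?I (collapse X A)) (\<lambda>(t, x). (t, collapse_map A x))"
  proof (rule quotient_map_prod_right)
    show "locally_compact_space ?I"
      by (intro compact_imp_locally_compact_space compact_space_subtopology) simp
    show "Hausdorff_space ?I \<or> regular_space ?I"
      by (simp add: Hausdorff_space_subtopology)
  qed (rule quotient_map_collapse)
  define k where "k = (\<lambda>(t::real, p). induced_map B (\<lambda>x. h (t, x)) p)"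
  have "continuous_map (prod_topology ?I (collapse X A)) (collapse Y B) k"
  proof (rule continuous_compose_quotient_map[OF q])
    have "continuous_map (prod_topology ?I X) (collapse Y B) (collapse_map B \<circ> h)"
      by (rule continuous_map_compose[OF h continuous_map_collapse_map])
    then show "continuous_map (prod_topology ?I X) (collapse Y B) (k \<circ> (\<lambda>(t, x). (t, collapse_map A x)))"
    proof (rule continuous_map_eq)
      fix z assume "z \<in> topspace (prod_topology ?I X)"
      then obtain t x where "z = (t, x)" "t \<in> {0..1}" "x \<in> topspace X"
        by auto
      then show "(collapse_map B \<circ> h) z = (k \<circ> (\<lambda>(t, x). (t, collapse_map A x))) z"
        using A by (simp add: k_def induced_map_def)
    qed
  qed
  then show ?thesis
    unfolding homotopic_with_def by (intro exI[of _ k]) (simp add: k_def)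
qed

text \<open>Inclusion and the time-one map are inverse up to homotopy, by \<open>h\<close> and by
  its restriction to \<open>S\<close>. One application shrinks the collapsed set, the other the
  ambient space.\<close>

lemma collapse_homotopy_equivalent:
  assumes h: "continuous_map (prod_topology (top_of_set {0..1::real}) X) X h"
    and h0: "\<And>x. x \<in> topspace X \<Longrightarrow> h (0, x) = x"
    and S: "S \<subseteq> topspace X" "A' \<subseteq> A" "A' \<subseteq> S"
    and hA: "\<And>t x. t \<in> {0..1} \<Longrightarrow> x \<in> A \<Longrightarrow> h (t, x) \<in> A"
    and hS: "\<And>t x. t \<in> {0..1} \<Longrightarrow> x \<in> S \<Longrightarrow> h (t, x) \<in> S"
    and hA': "\<And>t x. t \<in> {0..1} \<Longrightarrow> x \<in> A' \<Longrightarrow> h (t, x) \<in> A'"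
    and h1: "\<And>x. x \<in> topspace X \<Longrightarrow> h (1, x) \<in> S" "\<And>x. x \<in> A \<Longrightarrow> h (1, x) \<in> A'"
  shows "collapse X A homotopy_equivalent_space collapse (subtopology X S) A'"
proof -
  let ?Y = "subtopology X S"
  let ?r = "induced_map A' (\<lambda>x. h (1, x))" and ?i = "induced_map A (\<lambda>x. x)"
  have tY: "topspace ?Y = S"
    using S(1) by auto
  have "continuous_map X X (h \<circ> (\<lambda>x. (1, x)))"
    by (rule continuous_map_compose[OF _ h]) (simp add: continuous_map_pairwise o_def)
  then have "continuous_map X ?Y (\<lambda>x. h (1, x))"
    using h1(1) by (auto simp: continuous_map_in_subtopology o_def)
  then have r: "continuous_map (collapse X A) (collapse ?Y A') ?r"
    by (rule continuous_map_induced_map) (use h1(2) in auto)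
  have i: "continuous_map (collapse ?Y A') (collapse X A) ?i"
    by (rule continuous_map_induced_map) (use S in auto)
  have "homotopic_with (\<lambda>x. True) (collapse X A) (collapse X A)
      (induced_map A (\<lambda>x. h (0, x))) (induced_map A (\<lambda>x. h (1, x)))"
    using hA by (intro homotopic_induced_maps h) auto
  then have "homotopic_with (\<lambda>x. True) (collapse X A) (collapse X A) id (?i \<circ> ?r)"
  proof (rule homotopic_with_eq)
    fix p assume "p \<in> topspace (collapse X A)"
    then obtain x where x: "x \<in> topspace X" "p = collapse_map A x"
      by (auto simp only: topspace_collapse)
    then show "id p = induced_map A (\<lambda>x. h (0, x)) p"
      using h0 by (simp add: induced_map_def)
    show "(?i \<circ> ?r) p = induced_map A (\<lambda>x. h (1, x)) p"
      using x S(2) h1(2) by (auto simp: induced_map_def)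
  qed simp
  moreover have "continuous_map (prod_topology (top_of_set {0..1::real}) ?Y) ?Y h"
  proof -
    have "prod_topology (top_of_set {0..1::real}) ?Y = subtopology (prod_topology (top_of_set {0..1::real}) X) ({0..1} \<times> S)"
      by (subst prod_topology_subtopology(2)) simp
    moreover have "continuous_map (subtopology (prod_topology (top_of_set {0..1::real}) X) ({0..1} \<times> S)) X h"
      by (rule continuous_map_from_subtopology[OF h])
    ultimately show ?thesis
      using hS S(1) by (auto simp: continuous_map_in_subtopology)
  qed
  then have "homotopic_with (\<lambda>x. True) (collapse ?Y A') (collapse ?Y A')
      (induced_map A' (\<lambda>x. h (0, x))) (induced_map A' (\<lambda>x. h (1, x)))"
    using hA' by (intro homotopic_induced_maps) auto
  then have "homotopic_with (\<lambda>x. True) (collapse ?Y A') (collapse ?Y A') id (?r \<circ> ?i)"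
  proof (rule homotopic_with_eq)
    fix p assume "p \<in> topspace (collapse ?Y A')"
    then obtain x where x: "x \<in> S" "p = collapse_map A' x"
      by (auto simp only: topspace_collapse tY)
    then show "id p = induced_map A' (\<lambda>x. h (0, x)) p"
      using h0 S(1) by (auto simp: induced_map_def)
    show "(?r \<circ> ?i) p = induced_map A' (\<lambda>x. h (1, x)) p"
      using x S(2) h1(2) by (auto simp: induced_map_def)
  qed simp
  ultimately have "homotopic_with (\<lambda>x. True) (collapse X A) (collapse X A) (?i \<circ> ?r) id"
    "homotopic_with (\<lambda>x. True) (collapse ?Y A') (collapse ?Y A') (?r \<circ> ?i) id"
    by (simp_all only: homotopic_with_sym)
  then show ?thesis
    unfolding homotopy_equivalent_space_def using r i by blast
qed

section \<open>Elementary collapses\<close>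

definition points :: "'v set set \<Rightarrow> ('v \<Rightarrow> real) set" where
  "points K = {x. (\<forall>v. 0 \<le> x v) \<and> {v. x v \<noteq> 0} \<in> K \<and> (\<Sum>v | x v \<noteq> 0. x v) = 1}"

lemma realization_eq: "realization K = top_of_set (points K)"
  by (simp add: realization_def points_def euclidean_product_topology)

lemma topspace_realization: "topspace (realization K) = points K"
  by (simp add: realization_eq)

lemma points_mono: "K \<subseteq> L \<Longrightarrow> points K \<subseteq> points L"
  by (auto simp: points_def)

lemma in_points_iff:
  assumes "finite V" "K \<subseteq> Pow V"
  shows "x \<in> points K \<longleftrightarrow> (\<forall>v. 0 \<le> x v) \<and> {v. x v \<noteq> 0} \<in> K \<and> sum x V = 1"
proof -
  have "(\<Sum>v | x v \<noteq> 0. x v) = sum x V" if "{v. x v \<noteq> 0} \<in> K"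
  proof (rule sum.mono_neutral_left[OF assms(1)])
    show "{v. x v \<noteq> 0} \<subseteq> V"
      using that assms(2) by blast
  qed auto
  then show ?thesis
    by (auto simp: points_def)
qed

text \<open>
  For a free face \<open>s\<close> of \<open>insert v s\<close>, weight is moved from \<open>s\<close> to \<open>v\<close> until some coordinate in
  \<open>s\<close> vanishes; points whose support does not contain \<open>s\<close> do not move.
\<close>

definition push :: "'v set \<Rightarrow> 'v \<Rightarrow> real \<times> ('v \<Rightarrow> real) \<Rightarrow> 'v \<Rightarrow> real" where
  "push s v z u = (if u = v then snd z u + fst z * Min (snd z ` s) * real (card s)
     else if u \<in> s then snd z u - fst z * Min (snd z ` s) else snd z u)"

lemma continuous_on_Min_image:
  fixes f :: "'a \<Rightarrow> 'b::topological_space \<Rightarrow> real"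
  assumes "finite s" "s \<noteq> {}" "\<And>i. i \<in> s \<Longrightarrow> continuous_on A (f i)"
  shows "continuous_on A (\<lambda>x. Min ((\<lambda>i. f i x) ` s))"
  using assms
proof (induction s rule: finite_ne_induct)
  case (insert i s)
  have "Min ((\<lambda>i. f i x) ` insert i s) = min (f i x) (Min ((\<lambda>i. f i x) ` s))" for x
    using insert by simp
  then show ?case
    using insert by (simp add: continuous_on_min)
qed simp

lemma continuous_on_coordinate: "continuous_on A (\<lambda>x. x i)"
  for A :: "('a \<Rightarrow> 'b::topological_space) set"
  by (rule continuous_on_subset[OF continuous_on_product_coordinates]) simp

lemma continuous_on_push:
  assumes "finite s" "s \<noteq> {}"
  shows "continuous_on A (push s v)"
proof -
  have coord: "continuous_on A (\<lambda>z. snd z i)" for i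
    by (rule continuous_on_product_then_coordinatewise) (intro continuous_intros)
  have "continuous_on A (\<lambda>z. Min ((\<lambda>i. snd z i) ` s))"
    by (rule continuous_on_Min_image[OF assms coord])
  then have "continuous_on A (\<lambda>z. push s v z u)" for u
    unfolding push_def using coord
    by (cases "u = v"; cases "u \<in> s") (simp_all add: continuous_on_add continuous_on_diff continuous_on_mult continuous_on_fst continuous_on_const continuous_on_id)
  then show ?thesis
    by (rule continuous_on_coordinatewise_then_product)
qed

lemma push_0: "push s v (0, x) = x"
  by (simp add: push_def fun_eq_iff)

lemma push_stationary:
  assumes "finite s" "\<And>v. 0 \<le> x v" "\<not> s \<subseteq> {v. x v \<noteq> 0}"
  shows "push s v (t, x) = x"
proof -
  obtain u where u: "u \<in> s" "x u = 0"
    using assms(3) by auto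
  then have "Min (x ` s) = 0"
    using assms(1,2) by (intro Min_eqI) (auto simp: image_iff intro!: bexI[of _ u])
  then show ?thesis
    by (auto simp: push_def)
qed

text \<open>Total weight is preserved because \<open>v\<close> gains \<open>card s\<close> times
  what each vertex of \<open>s\<close> loses. At time 1 a vertex of \<open>s\<close> attaining the
  minimum has lost all its weight.\<close>

lemma
  assumes V: "finite V" "insert v s \<subseteq> V" and s: "s \<noteq> {}" "v \<notin> s"
    and x: "x \<in> points (Pow V)" and t: "t \<in> {0..1}"
  shows push_in_points: "push s v (t, x) \<in> points (Pow V)"
    and push_support: "{u. push s v (t, x) u \<noteq> 0} \<subseteq> insert v {u. x u \<noteq> 0}"
    and push_1_support: "\<not> s \<subseteq> {u. push s v (1, x) u \<noteq> 0}"
proof -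
  have x': "\<And>v. 0 \<le> x v" "{v. x v \<noteq> 0} \<subseteq> V" "sum x V = 1"
    using x in_points_iff[OF V(1), of "Pow V"] by auto
  have fin: "finite s"
    using V finite_subset by auto
  let ?m = "Min (x ` s)"
  have m: "0 \<le> ?m" "\<And>u. u \<in> s \<Longrightarrow> ?m \<le> x u"
    using fin s x'(1) by auto
  show supp: "{u. push s v (t, x) u \<noteq> 0} \<subseteq> insert v {u. x u \<noteq> 0}"
  proof
    fix u assume u: "u \<in> {u. push s v (t, x) u \<noteq> 0}"
    show "u \<in> insert v {u. x u \<noteq> 0}"
    proof (rule ccontr)
      assume "u \<notin> insert v {u. x u \<noteq> 0}"
      then have *: "u \<noteq> v" "x u = 0" by auto
      have "?m = 0" if "u \<in> s"
        using m that * by fastforce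
      then show False
        using u * by (auto simp: push_def split: if_splits)
    qed
  qed
  have "0 \<le> push s v (t, x) u" for u
  proof -
    have "t * ?m \<le> x u" if "u \<in> s"
      using mult_left_le_one_le[of ?m t] m that t by (meson atLeastAtMost_iff order_trans)
    then show ?thesis
      using x'(1) m(1) t by (auto simp: push_def)
  qed
  moreover have "sum (push s v (t, x)) V = 1"
  proof -
    have "push s v (t, x) u = x u + (if u = v then t * ?m * card s else 0) - (if u \<in> s then t * ?m else 0)" for u
      using s(2) by (auto simp: push_def)
    then have "sum (push s v (t, x)) V =
        sum x V + (\<Sum>u\<in>V. if u = v then t * ?m * card s else 0) - (\<Sum>u\<in>V. if u \<in> s then t * ?m else 0)"
      by (simp add: sum.distrib sum_subtractf)
    also have "(\<Sum>u\<in>V. if u = v then t * ?m * card s else 0) = t * ?m * card s"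
      using V by simp
    also have "(\<Sum>u\<in>V. if u \<in> s then t * ?m else 0) = (\<Sum>u\<in>s. t * ?m)"
      using V by (subst sum.inter_restrict[symmetric]) (auto simp: Int_absorb1)
    finally show ?thesis
      using x'(3) by simp
  qed
  moreover have "{u. push s v (t, x) u \<noteq> 0} \<subseteq> V"
    using supp x'(2) V(2) by blast
  ultimately show "push s v (t, x) \<in> points (Pow V)"
    using in_points_iff[OF V(1), of "Pow V"] by auto
  have "?m \<in> x ` s"
    using fin s by (intro Min_in) auto
  then obtain u where "u \<in> s" "x u = ?m"
    by auto
  then have "push s v (1, x) u = 0"
    using s(2) by (auto simp: push_def)
  then show "\<not> s \<subseteq> {u. push s v (1, x) u \<noteq> 0}"
    using \<open>u \<in> s\<close> by auto
qed

text \<open>Since \<open>K\<close> is downward closed and misses \<open>s\<close>, none of its faces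
  contains \<open>s\<close>; since the enlarged family is downward closed, all proper faces of
  \<open>insert v s\<close> other than \<open>s\<close> lie in \<open>K\<close>. Within the enlarged
  complex the push thus moves only points of the two new faces.\<close>

locale elementary_collapse =
  fixes V :: "'v set" and K :: "'v set set" and s :: "'v set" and v :: 'v
  assumes finV: "finite V" and sV: "insert v s \<subseteq> V" and s: "s \<noteq> {}" "v \<notin> s"
    and KV: "K \<subseteq> Pow V" and down: "\<And>F F'. F \<in> K \<Longrightarrow> F' \<subseteq> F \<Longrightarrow> F' \<in> K"
    and down': "\<And>F F'. F \<in> K \<union> {s, insert v s} \<Longrightarrow> F' \<subseteq> F \<Longrightarrow> F' \<in> K \<union> {s, insert v s}"
    and new: "s \<notin> K" "insert v s \<notin> K"
begin

abbreviation "K' \<equiv> K \<union> {s, insert v s}"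

lemma K'V: "K' \<subseteq> Pow V"
  using KV sV by auto

lemma fin_s: "finite s"
  using finV sV finite_subset by auto

lemma polyD:
  assumes "x \<in> points L" "L \<subseteq> Pow V"
  shows "x \<in> points (Pow V)" "\<And>v. 0 \<le> x v" "{v. x v \<noteq> 0} \<in> L"
  using assms points_mono[of L "Pow V"] by (auto simp: points_def)

lemma poly_restrict: "x \<in> points (Pow V) \<Longrightarrow> {v. x v \<noteq> 0} \<in> L \<Longrightarrow> x \<in> points L"
  by (simp add: points_def)

lemma push_id: "push s v (t, x) = x" if "x \<in> points K"
proof (rule push_stationary[OF fin_s])
  show "0 \<le> x v" for v
    using polyD[OF that KV] by auto
  show "\<not> s \<subseteq> {v. x v \<noteq> 0}"
    using polyD(3)[OF that KV] down new by blast
qed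

lemma push_K': 
  assumes x: "x \<in> points K'" and t: "t \<in> {0..1}"
  shows "push s v (t, x) \<in> points K'"
proof (cases "x \<in> points K")
  case True
  then show ?thesis using x push_id by simp
next
  case False
  note x' = polyD[OF x K'V]
  have "{v. x v \<noteq> 0} \<in> {s, insert v s}"
    using False x'(3) poly_restrict[OF x'(1)] by blast
  then have "{u. push s v (t, x) u \<noteq> 0} \<subseteq> insert v s"
    using push_support[OF finV sV s x'(1) t] by blast
  then have "{u. push s v (t, x) u \<noteq> 0} \<in> K'"
    by (rule down'[rotated]) simp
  then show ?thesis
    by (rule poly_restrict[OF push_in_points[OF finV sV s x'(1) t]])
qed

lemma push_1_K: 
  assumes x: "x \<in> points K'"
  shows "push s v (1, x) \<in> points K"
proof -
  have "push s v (1, x) \<in> points K'"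
    using push_K'[OF x, of 1] by simp
  note y = polyD[OF this K'V]
  have "\<not> s \<subseteq> {u. push s v (1, x) u \<noteq> 0}"
    using polyD(1)[OF x K'V] finV sV s by (intro push_1_support[where t = 1]) auto
  then show ?thesis
    using y by (intro poly_restrict[OF y(1)]) auto
qed

lemma push_continuous:
  assumes "\<And>t x. t \<in> {0..1} \<Longrightarrow> x \<in> points L \<Longrightarrow> push s v (t, x) \<in> points L"
  shows "continuous_map (prod_topology (top_of_set {0..1::real}) (realization L)) (realization L) (push s v)"
proof -
  have "prod_topology (top_of_set {0..1::real}) (realization L) = top_of_set ({0..1} \<times> points L)"
    by (simp add: realization_eq prod_topology_subtopology_eu)
  moreover have "continuous_on ({0..1} \<times> points L) (push s v)"
    using fin_s s by (intro continuous_on_push)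
  ultimately show ?thesis
    using assms by (auto simp: realization_eq)
qed

text \<open>The push runs on the full simplex, where \<open>s\<close> may have other cofaces; the
  ambient space stays the same and only the collapsed set shrinks.\<close>

lemma collapse_denominator:
  "collapse (realization (Pow V)) (points K') homotopy_equivalent_space collapse (realization (Pow V)) (points K)"
proof -
  have "collapse (realization (Pow V)) (points K') homotopy_equivalent_space
      collapse (subtopology (realization (Pow V)) (points (Pow V))) (points K)"
  proof (rule collapse_homotopy_equivalent)
    show stay: "push s v (t, x) \<in> points (Pow V)" if "t \<in> {0..1}" "x \<in> points (Pow V)" for t x
      using that(2,1) by (rule push_in_points[OF finV sV s])
    show "continuous_map (prod_topology (top_of_set {0..1::real}) (realization (Pow V))) (realization (Pow V)) (push s v)"
      using stay by (rule push_continuous)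
    show "push s v (1, x) \<in> points (Pow V)" if "x \<in> topspace (realization (Pow V))" for x
      using that by (intro stay) (simp_all add: topspace_realization)
  qed (use push_0 push_id push_K' push_1_K KV in \<open>auto simp: topspace_realization intro!: points_mono\<close>)
  then show ?thesis
    by (metis subtopology_topspace topspace_realization)
qed

lemma collapse_numerator:
  assumes "L \<subseteq> K"
  shows "collapse (realization K') (points L) homotopy_equivalent_space collapse (realization K) (points L)"
proof -
  have LK: "points L \<subseteq> points K"
    using assms by (rule points_mono)
  have KK': "points K \<subseteq> points K'"
    by (rule points_mono) blast
  have "collapse (realization K') (points L) homotopy_equivalent_space
      collapse (subtopology (realization K') (points K)) (points L)"
  proof (rule collapse_homotopy_equivalent)
    show "continuous_map (prod_topology (top_of_set {0..1::real}) (realization K')) (realization K') (push s v)"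
      using push_K' by (intro push_continuous)
  qed (use push_0 push_id push_1_K LK KK' in \<open>auto simp: topspace_realization\<close>)
  moreover have "subtopology (realization K') (points K) = realization K"
    using KK' by (simp add: realization_eq subtopology_subtopology Int_absorb1)
  ultimately show ?thesis by simp
qed

end

text \<open>The matching is removed from the top: by the side condition of \<open>union\<close>,
  taking away the upper family leaves a complex. \<open>{} \<in> K\<close> keeps the empty face out
  of the pairs, as a push needs a nonempty \<open>s\<close>.\<close>

lemma collapse_matchable_denominator:
  assumes "matchable A C" "C = {}" "finite V" "A \<subseteq> Pow V" "K \<subseteq> Pow V" "{} \<in> K" "A \<inter> K = {}"
    and "\<And>F F'. F \<in> K \<Longrightarrow> F' \<subseteq> F \<Longrightarrow> F' \<in> K"
    and "\<And>F F'. F \<in> K \<union> A \<Longrightarrow> F' \<subseteq> F \<Longrightarrow> F' \<in> K \<union> A"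
  shows "collapse (realization (Pow V)) (points (K \<union> A)) homotopy_equivalent_space
    collapse (realization (Pow V)) (points K)"
  using assms
proof (induction arbitrary: K rule: matchable.induct)
  case empty
  then show ?case by (simp add: homotopy_equivalent_space_refl)
next
  case (critical s)
  then show ?case by simp
next
  case (pair v s)
  interpret elementary_collapse V K s v
  proof
    show "finite V" "insert v s \<subseteq> V" "v \<notin> s" "K \<subseteq> Pow V"
      using pair.prems(2-4) pair.hyps by simp_all
    show "s \<noteq> {}" "s \<notin> K" "insert v s \<notin> K"
      using pair.prems(5,6) by auto
    show "F' \<in> K" if "F \<in> K" "F' \<subseteq> F" for F F'
      using pair.prems(7) that by blast
    show "F' \<in> K \<union> {s, insert v s}" if "F \<in> K \<union> {s, insert v s}" "F' \<subseteq> F" for F F'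
      using that by (rule pair.prems(8))
  qed
  show ?case by (rule collapse_denominator)
next
  case (union Q C Q' C')
  \<comment> \<open>A subface of a face in \<open>Q\<close> cannot lie in \<open>Q'\<close>.\<close>
  have down: "F' \<in> K \<union> Q" if "F \<in> K \<union> Q" "F' \<subseteq> F" for F F'
    using that union.prems(7,8) union.hyps(3) by blast
  have "collapse (realization (Pow V)) (points (K \<union> Q \<union> Q')) homotopy_equivalent_space
    collapse (realization (Pow V)) (points (K \<union> Q))"
  proof (rule union.IH(2)[OF _ union.prems(2)])
    show "C' = {}" "Q' \<subseteq> Pow V" "K \<union> Q \<subseteq> Pow V" "{} \<in> K \<union> Q"
      using union.prems(1,3-5) by auto
    have "Q' \<inter> Q = {}"
      using union.hyps(3) by blast
    then show "Q' \<inter> (K \<union> Q) = {}"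
      using union.prems(6) by blast
    show "F' \<in> K \<union> Q" if "F \<in> K \<union> Q" "F' \<subseteq> F" for F F'
      by (rule down[OF that])
    show "F' \<in> K \<union> Q \<union> Q'" if "F \<in> K \<union> Q \<union> Q'" "F' \<subseteq> F" for F F'
      using union.prems(8)[of F F'] that by (simp add: Un_assoc)
  qed
  moreover have "collapse (realization (Pow V)) (points (K \<union> Q)) homotopy_equivalent_space
    collapse (realization (Pow V)) (points K)"
  proof (rule union.IH(1)[OF _ union.prems(2)])
    show "C = {}" "Q \<subseteq> Pow V" "K \<subseteq> Pow V" "{} \<in> K"
      using union.prems(1,3-5) by auto
    show "Q \<inter> K = {}"
      using union.prems(6) by blast
    show "F' \<in> K" if "F \<in> K" "F' \<subseteq> F" for F F'
      using that by (rule union.prems(7))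
    show "F' \<in> K \<union> Q" if "F \<in> K \<union> Q" "F' \<subseteq> F" for F F'
      by (rule down[OF that])
  qed
  ultimately show ?case
    by (metis homotopy_eqv_trans Un_assoc)
qed

lemma collapse_matchable_numerator:
  assumes "matchable A C" "C = {}" "finite V" "A \<subseteq> Pow V" "K \<subseteq> Pow V" "{} \<in> K" "A \<inter> K = {}" "L \<subseteq> K"
    and "\<And>F F'. F \<in> K \<Longrightarrow> F' \<subseteq> F \<Longrightarrow> F' \<in> K"
    and "\<And>F F'. F \<in> K \<union> A \<Longrightarrow> F' \<subseteq> F \<Longrightarrow> F' \<in> K \<union> A"
  shows "collapse (realization (K \<union> A)) (points L) homotopy_equivalent_space
    collapse (realization K) (points L)"
  using assms
proof (induction arbitrary: K rule: matchable.induct)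
  case empty
  then show ?case by (simp add: homotopy_equivalent_space_refl)
next
  case (critical s)
  then show ?case by simp
next
  case (pair v s)
  interpret elementary_collapse V K s v
  proof
    show "finite V" "insert v s \<subseteq> V" "v \<notin> s" "K \<subseteq> Pow V"
      using pair.prems(2-4) pair.hyps by simp_all
    show "s \<noteq> {}" "s \<notin> K" "insert v s \<notin> K"
      using pair.prems(5,6) by auto
    show "F' \<in> K" if "F \<in> K" "F' \<subseteq> F" for F F'
      using pair.prems(8) that by blast
    show "F' \<in> K \<union> {s, insert v s}" if "F \<in> K \<union> {s, insert v s}" "F' \<subseteq> F" for F F'
      using that by (rule pair.prems(9))
  qed
  show ?case by (rule collapse_numerator) (use pair in blast)
next
  case (union Q C Q' C')
  have down: "F' \<in> K \<union> Q" if "F \<in> K \<union> Q" "F' \<subseteq> F" for F F'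
    using that union.prems(8,9) union.hyps(3) by blast
  have "collapse (realization (K \<union> Q \<union> Q')) (points L) homotopy_equivalent_space
    collapse (realization (K \<union> Q)) (points L)"
  proof (rule union.IH(2)[OF _ union.prems(2)])
    show "C' = {}" "Q' \<subseteq> Pow V" "K \<union> Q \<subseteq> Pow V" "{} \<in> K \<union> Q"
      using union.prems(1,3-5) by auto
    have "Q' \<inter> Q = {}"
      using union.hyps(3) by blast
    then show "Q' \<inter> (K \<union> Q) = {}"
      using union.prems(6) by blast
    show "L \<subseteq> K \<union> Q"
      using union.prems(7) by blast
    show "F' \<in> K \<union> Q" if "F \<in> K \<union> Q" "F' \<subseteq> F" for F F'
      by (rule down[OF that])
    show "F' \<in> K \<union> Q \<union> Q'" if "F \<in> K \<union> Q \<union> Q'" "F' \<subseteq> F" for F F'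
      using union.prems(9)[of F F'] that by (simp add: Un_assoc)
  qed
  moreover have "collapse (realization (K \<union> Q)) (points L) homotopy_equivalent_space
    collapse (realization K) (points L)"
  proof (rule union.IH(1)[OF _ union.prems(2)])
    show "C = {}" "Q \<subseteq> Pow V" "K \<subseteq> Pow V" "{} \<in> K"
      using union.prems(1,3-5) by auto
    show "Q \<inter> K = {}"
      using union.prems(6) by blast
    show "L \<subseteq> K"
      by (rule union.prems(7))
    show "F' \<in> K" if "F \<in> K" "F' \<subseteq> F" for F F'
      using that by (rule union.prems(8))
    show "F' \<in> K \<union> Q" if "F \<in> K \<union> Q" "F' \<subseteq> F" for F F'
      by (rule down[OF that])
  qed
  ultimately show ?case
    by (metis homotopy_eqv_trans Un_assoc)
qed

section \<open>Complexes with a single dimension of new faces\<close>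

lemma Hausdorff_space_collapse:
  assumes H: "Hausdorff_space X" and A: "compactin X A"
  shows "Hausdorff_space (collapse X A)"
  unfolding Hausdorff_space_def
proof (intro allI impI)
  fix p p' assume pp: "p \<in> topspace (collapse X A) \<and> p' \<in> topspace (collapse X A) \<and> p \<noteq> p'"
  then obtain x y where xy: "x \<in> topspace X" "p = collapse_map A x" "y \<in> topspace X" "p' = collapse_map A y"
    by (auto simp only: topspace_collapse)
  have AX: "A \<subseteq> topspace X"
    using A by (rule compactin_subset_topspace)
  have cl: "closedin X A"
    using H A by (rule compactin_imp_closedin)
  \<comment> \<open>Open sets that contain \<open>A\<close> or miss it are saturated, so their
    images are open and stay disjoint.\<close>
  define sat where "sat U \<longleftrightarrow> openin X U \<and> (U \<inter> A = {} \<or> A \<subseteq> U)" for U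
  have "\<exists>U V. sat U \<and> sat V \<and> x \<in> U \<and> y \<in> V \<and> U \<inter> V = {}"
  proof -
    have sep: "\<exists>U V. sat U \<and> sat V \<and> x \<in> U \<and> y \<in> V \<and> U \<inter> V = {}"
      if xy: "x \<in> topspace X" "y \<in> topspace X" "x \<in> A" "y \<notin> A" for x y
    proof -
      have "compactin X {y}" "disjnt A {y}"
        using xy by auto
      then obtain U V where "openin X U" "openin X V" "A \<subseteq> U" "{y} \<subseteq> V" "disjnt U V"
        by (rule Hausdorff_space_compact_separation[OF H A])
      then show ?thesis
        using xy by (intro exI[of _ U] exI[of _ V]) (auto simp: sat_def disjnt_def)
    qed
    consider "x \<in> A" "y \<notin> A" | "y \<in> A" "x \<notin> A" | "x \<notin> A" "y \<notin> A" "x \<noteq> y"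
      using pp xy by (auto split: if_splits)
    then show ?thesis
    proof cases
      case 1
      then show ?thesis using sep xy by blast
    next
      case 2
      then show ?thesis using sep[of y x] xy by (metis Int_commute)
    next
      case 3
      then obtain U V where "openin X U" "openin X V" "x \<in> U" "y \<in> V" "disjnt U V"
        using H xy(1,3) unfolding Hausdorff_space_def by blast
      then show ?thesis
        using 3 cl by (intro exI[of _ "U - A"] exI[of _ "V - A"]) (auto simp: sat_def disjnt_def openin_diff)
    qed
  qed
  then obtain U V where UV: "sat U" "sat V" "x \<in> U" "y \<in> V" "U \<inter> V = {}"
    by blast
  have im: "collapse_map A a \<in> collapse_map A ` U \<longleftrightarrow> a \<in> U" if "sat U" for U a
  proof
    assume "collapse_map A a \<in> collapse_map A ` U"
    then obtain b where "b \<in> U" "collapse_map A a = collapse_map A b"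
      by blast
    then show "a \<in> U"
      using that by (auto simp: sat_def split: if_splits)
  qed blast
  have op: "openin (collapse X A) (collapse_map A ` U)" if "sat U" for U
  proof -
    have U: "openin X U"
      using that by (simp add: sat_def)
    then have sub: "U \<subseteq> topspace X"
      by (rule openin_subset)
    then have "{x \<in> topspace X. x \<in> U} = U"
      by blast
    with U have "openin X {x \<in> topspace X. x \<in> U}"
      by simp
    then show ?thesis
      unfolding collapse_def openin_quotient_topology im[OF that] using image_mono[OF sub] by (intro conjI)
  qed
  have "disjnt (collapse_map A ` U) (collapse_map A ` V)"
    unfolding disjnt_iff
  proof (intro allI notI, elim conjE)
    fix p assume "p \<in> collapse_map A ` U" "p \<in> collapse_map A ` V"
    then obtain a where "p = collapse_map A a" "a \<in> U"
      by blast
    then have "collapse_map A a \<in> collapse_map A ` V"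
      using \<open>p \<in> collapse_map A ` V\<close> by (simp only:)
    then have "a \<in> V"
      by (rule iffD1[OF im[OF UV(2)]])
    then show False
      using \<open>a \<in> U\<close> UV(5) by blast
  qed
  moreover have "p \<in> collapse_map A ` U" "p' \<in> collapse_map A ` V"
    unfolding xy(2,4) by (rule imageI[OF UV(3)], rule imageI[OF UV(4)])
  ultimately show "\<exists>U V. openin (collapse X A) U \<and> openin (collapse X A) V \<and> p \<in> U \<and> p' \<in> V \<and> disjnt U V"
    using op[OF UV(1)] op[OF UV(2)] by (intro exI conjI)
qed

lemma Hausdorff_space_sum_topology:
  assumes "\<And>i. i \<in> I \<Longrightarrow> Hausdorff_space (X i)"
  shows "Hausdorff_space (sum_topology X I)"
  unfolding Hausdorff_space_def
proof (intro allI impI)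
  have op: "openin (sum_topology X I) ({i} \<times> U)" if "i \<in> I" "openin (X i) U" for i U
  proof -
    have "{i} \<times> U = Sigma I (\<lambda>j. if j = i then U else {})"
      using that(1) by (auto split: if_splits)
    then show ?thesis
      using that(2) by (simp add: openin_disjoint_union)
  qed
  fix p p' assume pp: "p \<in> topspace (sum_topology X I) \<and> p' \<in> topspace (sum_topology X I) \<and> p \<noteq> p'"
  obtain i x j y where p: "p = (i, x)" "p' = (j, y)"
    by fastforce
  then have *: "p = (i, x)" "p' = (j, y)" "i \<in> I" "j \<in> I" "x \<in> topspace (X i)" "y \<in> topspace (X j)" "p \<noteq> p'"
    using pp by auto
  show "\<exists>U V. openin (sum_topology X I) U \<and> openin (sum_topology X I) V \<and> p \<in> U \<and> p' \<in> V \<and> disjnt U V"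
  proof (cases "i = j")
    case True
    then obtain U V where "openin (X i) U" "openin (X i) V" "x \<in> U" "y \<in> V" "disjnt U V"
      using * assms[of i] unfolding Hausdorff_space_def by blast
    then show ?thesis
      using * True op by (intro exI[of _ "{i} \<times> U"] exI[of _ "{j} \<times> V"]) (auto simp: disjnt_def)
  next
    case False
    then show ?thesis
      using * op by (intro exI[of _ "{i} \<times> topspace (X i)"] exI[of _ "{j} \<times> topspace (X j)"]) (auto simp: disjnt_def)
  qed
qed

lemma Hausdorff_space_nsphere: "Hausdorff_space (nsphere n)"
  unfolding nsphere_def by (rule Hausdorff_space_subtopology[OF Hausdorff_Euclidean_space])

lemma Hausdorff_wedge_of_spheres: "Hausdorff_space (wedge_of_spheres m d)"
  unfolding wedge_of_spheres_def wedge_def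
proof (rule Hausdorff_space_collapse)
  show "Hausdorff_space (sum_topology (\<lambda>_. nsphere d) {..<m})"
    by (intro Hausdorff_space_sum_topology Hausdorff_space_nsphere)
  show "compactin (sum_topology (\<lambda>_. nsphere d) {..<m}) {(i, sphere_basepoint) |i. i \<in> {..<m}}"
    by (rule finite_imp_compactin) (auto simp: sphere_basepoint_in_nsphere)
qed

subsection \<open>A simplex modulo its boundary\<close>

text \<open>
  The interior of the simplex maps to \<open>\<real>\<^sup>d\<close> by \<open>w / m\<close>, where \<open>w\<close> is the position relative to the
  barycentre and \<open>m\<close> the least barycentric coordinate; this is followed by the inverse stereographic
  projection from the base point.
\<close>

definition simplex_to_sphere :: "nat \<Rightarrow> (nat \<Rightarrow> real) \<Rightarrow> nat \<Rightarrow> real" where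
  "simplex_to_sphere d y i =
    (let m = Min (y ` {..d}); w = (\<lambda>i. y i - 1 / real (Suc d)); W = (\<Sum>j=1..d. (w j)\<^sup>2)
     in if i = 0 then (W - m\<^sup>2) / (W + m\<^sup>2) else if i \<le> d then 2 * m * w i / (W + m\<^sup>2) else 0)"

lemma sum_atMost_eq_0_plus: "(\<Sum>i\<le>d. f i) = f 0 + (\<Sum>i=1..d. f i)" for f :: "nat \<Rightarrow> real"
  by (metis One_nat_def atMost_atLeast0 le0 sum.atLeast_Suc_atMost)

context
  fixes d :: nat
begin

definition "std_simplex = {y :: nat \<Rightarrow> real. (\<forall>i\<le>d. 0 \<le> y i) \<and> (\<Sum>i\<le>d. y i) = 1}"

abbreviation "mn y \<equiv> Min (y ` {..d})" for y :: "nat \<Rightarrow> real"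
abbreviation "wt y \<equiv> (\<lambda>i. y i - 1 / real (Suc d))" for y :: "nat \<Rightarrow> real"
abbreviation "nrm y \<equiv> (\<Sum>j=1..d. (wt y j)\<^sup>2)" for y :: "nat \<Rightarrow> real"

lemma simplex_to_sphere_simps:
  "simplex_to_sphere d y 0 = (nrm y - (mn y)\<^sup>2) / (nrm y + (mn y)\<^sup>2)"
  "1 \<le> i \<Longrightarrow> i \<le> d \<Longrightarrow> simplex_to_sphere d y i = 2 * mn y * wt y i / (nrm y + (mn y)\<^sup>2)"
  "d < i \<Longrightarrow> simplex_to_sphere d y i = 0"
  by (simp_all add: simplex_to_sphere_def Let_def)

lemma simplex_to_sphere_cong:
  assumes "\<And>i. i \<le> d \<Longrightarrow> y i = y' i"
  shows "simplex_to_sphere d y = simplex_to_sphere d y'"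
proof -
  have "mn y = mn y'"
    using assms by (intro arg_cong[of _ _ Min] image_cong) auto
  moreover have "nrm y = nrm y'"
    using assms by (intro sum.cong) auto
  ultimately show ?thesis
    using assms unfolding simplex_to_sphere_def Let_def fun_eq_iff by simp
qed

lemma mn_le: "i \<le> d \<Longrightarrow> mn y \<le> y i"
  by simp

lemma mn_in: obtains i where "i \<le> d" "mn y = y i"
proof -
  have "mn y \<in> y ` {..d}"
    by (intro Min_in) auto
  then obtain i where "mn y = y i" "i \<in> {..d}"
    by (rule imageE)
  then show thesis
    by (intro that) auto
qed

lemma wt_0:
  assumes "y \<in> std_simplex"
  shows "wt y 0 = - (\<Sum>i=1..d. wt y i)"
proof -
  have "(\<Sum>i\<le>d. wt y i) = 0"
    using assms by (simp add: std_simplex_def sum_subtractf)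
  then show ?thesis
    by (simp add: sum_atMost_eq_0_plus)
qed

lemma nrm_nonneg: "0 \<le> nrm y"
  by (intro sum_nonneg) simp

text \<open>Clearing \<open>m\<close> from the denominators of the stereographic formula extends it
  to the boundary. The new denominator could vanish only at the barycentre, but there the minimum is
  \<open>1 / (d + 1)\<close>.\<close>

lemma denominator_pos:
  assumes "y \<in> std_simplex"
  shows "0 < nrm y + (mn y)\<^sup>2"
proof (cases "nrm y = 0")
  case False
  then have "0 < nrm y"
    using nrm_nonneg[of y] by linarith
  then show ?thesis
    by (simp add: add_pos_nonneg)
next
  case True
  then have w: "wt y i = 0" if "i \<in> {1..d}" for i
    using that by (subst (asm) sum_nonneg_eq_0_iff) auto
  then have "(\<Sum>i=1..d. wt y i) = 0"
    by (intro sum.neutral) auto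
  then have "wt y 0 = 0"
    using wt_0[OF assms] by simp
  then have all: "wt y i = 0" if "i \<le> d" for i
    using w[of i] that by (cases "i = 0") auto
  obtain i where "i \<le> d" "mn y = y i"
    by (rule mn_in)
  then have "mn y = 1 / real (Suc d)"
    using all[of i] by simp
  then have "mn y > 0"
    using of_nat_0_less_iff[of "Suc d"] by (metis zero_less_Suc zero_less_divide_1_iff)
  then have "0 < (mn y)\<^sup>2"
    by (rule zero_less_power)
  then show ?thesis
    by (rule add_nonneg_pos[OF nrm_nonneg])
qed

lemma sum_squares_simplex_to_sphere:
  assumes "y \<in> std_simplex"
  shows "(\<Sum>i\<le>d. (simplex_to_sphere d y i)\<^sup>2) = 1"
proof -
  define W m D where "W = nrm y" and "m = mn y" and "D = nrm y + (mn y)\<^sup>2"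
  have D: "D > 0" "D = W + m\<^sup>2"
    using denominator_pos[OF assms] by (simp_all add: D_def W_def m_def)
  have "(\<Sum>i=1..d. (simplex_to_sphere d y i)\<^sup>2) = (\<Sum>i=1..d. (2 * m / D)\<^sup>2 * (wt y i)\<^sup>2)"
    by (intro sum.cong refl) (simp add: simplex_to_sphere_simps D_def m_def power_divide power_mult_distrib)
  also have "\<dots> = (2 * m / D)\<^sup>2 * W"
    by (simp add: W_def sum_distrib_left)
  finally have "(\<Sum>i\<le>d. (simplex_to_sphere d y i)\<^sup>2) = ((W - m\<^sup>2) / D)\<^sup>2 + (2 * m / D)\<^sup>2 * W"
    by (simp add: sum_atMost_eq_0_plus simplex_to_sphere_simps D_def W_def m_def)
  also have "\<dots> = ((W - m\<^sup>2)\<^sup>2 + 4 * m\<^sup>2 * W) / D\<^sup>2"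
    by (simp add: power_divide power_mult_distrib add_divide_distrib)
  also have "(W - m\<^sup>2)\<^sup>2 + 4 * m\<^sup>2 * W = D\<^sup>2"
    unfolding D(2) by (simp add: power2_eq_square algebra_simps)
  finally show ?thesis
    using D(1) by simp
qed

lemma simplex_to_sphere_in_nsphere:
  assumes "y \<in> std_simplex"
  shows "simplex_to_sphere d y \<in> topspace (nsphere d)"
  using sum_squares_simplex_to_sphere[OF assms] by (simp add: nsphere simplex_to_sphere_simps)

lemma simplex_to_sphere_eq_basepoint_iff:
  assumes "y \<in> std_simplex"
  shows "simplex_to_sphere d y = sphere_basepoint \<longleftrightarrow> mn y = 0"
proof
  assume "simplex_to_sphere d y = sphere_basepoint"
  then have "simplex_to_sphere d y 0 = 1"
    by (simp add: sphere_basepoint_def)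
  then have "nrm y - (mn y)\<^sup>2 = nrm y + (mn y)\<^sup>2"
    using denominator_pos[OF assms] by (simp add: simplex_to_sphere_simps)
  then show "mn y = 0" by simp
next
  assume m: "mn y = 0"
  then have "0 < nrm y"
    using denominator_pos[OF assms] by simp
  show "simplex_to_sphere d y = sphere_basepoint"
  proof
    fix i
    consider "i = 0" | "1 \<le> i" "i \<le> d" | "d < i"
      by linarith
    then show "simplex_to_sphere d y i = sphere_basepoint i"
      using m \<open>0 < nrm y\<close> by cases (auto simp: simplex_to_sphere_simps sphere_basepoint_def)
  qed
qed

text \<open>The image determines \<open>w / m\<close>. With \<open>z\<close> its value at an index
  minimizing \<open>y\<close>, the minimum of \<open>y\<close> satisfies
  \<open>m * (1 - z) = 1 / (d + 1)\<close>, while \<open>y'\<close> satisfies only an inequality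
  there. Exchanging the two points later gives equal minima.\<close>

lemma simplex_to_sphere_le:
  assumes y: "y \<in> std_simplex" "0 < mn y" and y': "y' \<in> std_simplex" "0 < mn y'"
    and eq: "simplex_to_sphere d y = simplex_to_sphere d y'"
  shows "(\<forall>i\<le>d. wt y i / mn y = wt y' i / mn y') \<and> mn y' \<le> mn y"
proof -
  define D D' where "D = nrm y + (mn y)\<^sup>2" and "D' = nrm y' + (mn y')\<^sup>2"
  have pos: "0 < D" "0 < D'"
    using denominator_pos y(1) y'(1) by (simp_all add: D_def D'_def)
  have "simplex_to_sphere d y 0 = 1 - 2 * ((mn y)\<^sup>2 / D)" "simplex_to_sphere d y' 0 = 1 - 2 * ((mn y')\<^sup>2 / D')"
    using pos by (simp_all add: simplex_to_sphere_simps D_def D'_def field_simps)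
  then have k: "(mn y)\<^sup>2 / D = (mn y')\<^sup>2 / D'"
    using eq by simp
  have w: "wt y i / mn y = wt y' i / mn y'" if i: "1 \<le> i" "i \<le> d" for i
  proof -
    have "mn y * wt y i / D = mn y' * wt y' i / D'"
      using fun_cong[OF eq, of i] i by (simp add: simplex_to_sphere_simps D_def D'_def)
    moreover have "mn y * wt y i / D = (mn y)\<^sup>2 / D * (wt y i / mn y)"
      using y(2) by (simp add: power2_eq_square)
    moreover have "mn y' * wt y' i / D' = (mn y')\<^sup>2 / D' * (wt y' i / mn y')"
      using y'(2) by (simp add: power2_eq_square)
    moreover have "0 < (mn y')\<^sup>2 / D'"
      by (intro divide_pos_pos zero_less_power y'(2) pos(2))
    then have "(mn y')\<^sup>2 / D' \<noteq> 0"
      by (rule less_imp_neq[symmetric])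
    ultimately show ?thesis
      using k by (metis mult_cancel_left)
  qed
  have "wt y 0 / mn y = - (\<Sum>i=1..d. wt y i / mn y)" "wt y' 0 / mn y' = - (\<Sum>i=1..d. wt y' i / mn y')"
    unfolding wt_0[OF y(1)] wt_0[OF y'(1)] by (simp_all only: sum_divide_distrib[symmetric] minus_divide_left)
  moreover have "(\<Sum>i=1..d. wt y i / mn y) = (\<Sum>i=1..d. wt y' i / mn y')"
    by (intro sum.cong refl w) auto
  ultimately have all: "wt y i / mn y = wt y' i / mn y'" if "i \<le> d" for i
    using w[of i] that by (cases "i = 0") auto
  obtain i where i: "i \<le> d" "mn y = y i"
    by (rule mn_in)
  define z where "z = wt y i / mn y"
  have 1: "mn y * (1 - z) = 1 / real (Suc d)"
  proof -
    have "mn y * z = wt y i"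
      using y(2) by (simp add: z_def less_imp_neq[symmetric] del: Min_gr_iff)
    then show ?thesis
      unfolding right_diff_distrib using i(2) by simp
  qed
  have "mn y' \<noteq> 0"
    by (rule less_imp_neq[OF y'(2), symmetric])
  then have "wt y' i = mn y' * z"
    unfolding z_def all[OF i(1)] by simp
  then have "mn y' * (1 - z) \<le> 1 / real (Suc d)"
    using mn_le[OF i(1), of y'] by (simp add: algebra_simps)
  then have "mn y' * (1 - z) \<le> mn y * (1 - z)"
    using 1 by simp
  moreover have "0 < mn y * (1 - z)"
    unfolding 1 by simp
  then have "0 < 1 - z"
    using y(2) by (simp add: zero_less_mult_iff)
  ultimately have "mn y' \<le> mn y"
    by (simp add: mult_le_cancel_right)
  then show ?thesis
    using all by blast
qed

lemma simplex_to_sphere_inj: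
  assumes y: "y \<in> std_simplex" "0 < mn y" and y': "y' \<in> std_simplex" "0 < mn y'"
    and eq: "simplex_to_sphere d y = simplex_to_sphere d y'" and i: "i \<le> d"
  shows "y i = y' i"
proof -
  have "mn y = mn y'"
    using simplex_to_sphere_le[OF y y' eq] simplex_to_sphere_le[OF y' y eq[symmetric]] by linarith
  moreover have "wt y i / mn y = wt y' i / mn y'"
    using simplex_to_sphere_le[OF y y' eq] i by blast
  ultimately show ?thesis
    using y(2) by simp
qed

text \<open>\<open>z\<close> is the stereographic projection of \<open>p\<close>, completed by a
  coordinate that makes the sum zero. The preimage is the barycentre plus \<open>m * z\<close>, and
  \<open>m\<close> solves \<open>1 / (d + 1) + m * mn z = m\<close> so that the minimum is
  \<open>m\<close>.\<close>

lemma simplex_to_sphere_surj: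
  assumes p: "p \<in> topspace (nsphere d)" "p \<noteq> sphere_basepoint"
  obtains y where "y \<in> std_simplex" "0 < mn y" "simplex_to_sphere d y = p"
proof -
  have sum1: "(\<Sum>i\<le>d. (p i)\<^sup>2) = 1" and p0: "\<And>i. d < i \<Longrightarrow> p i = 0"
    using p(1) by (auto simp: nsphere)
  then have sq: "(p 0)\<^sup>2 + (\<Sum>i=1..d. (p i)\<^sup>2) = 1"
    by (simp only: sum_atMost_eq_0_plus)
  have nn: "0 \<le> (\<Sum>i=1..d. (p i)\<^sup>2)"
    by (intro sum_nonneg) simp
  have "p 0 \<noteq> 1"
  proof
    assume "p 0 = 1"
    then have "(\<Sum>i=1..d. (p i)\<^sup>2) = 0"
      using sq by simp
    then have "p i = 0" if "i \<in> {1..d}" for i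
      using that by (subst (asm) sum_nonneg_eq_0_iff) auto
    then have "p i = sphere_basepoint i" for i
      using p0[of i] \<open>p 0 = 1\<close> by (cases "i = 0"; cases "i \<le> d") (auto simp: sphere_basepoint_def)
    then show False
      using p(2) by blast
  qed
  moreover have "(p 0)\<^sup>2 \<le> 1\<^sup>2"
    using sq nn by simp
  then have "p 0 \<le> 1"
    by (rule power2_le_imp_le) simp
  ultimately have p1: "p 0 < 1" by simp
  define z where "z i = (if i = 0 then - (\<Sum>i=1..d. p i / (1 - p 0)) else p i / (1 - p 0))" for i
  define m where "m = 1 / (real (Suc d) * (1 - mn z))"
  define y where "y i = 1 / real (Suc d) + m * z i" for i
  have zsum: "(\<Sum>i\<le>d. z i) = 0"
    by (simp add: sum_atMost_eq_0_plus z_def)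
  \<comment> \<open>Numbers with sum zero are not all positive; hence \<open>1 - mn z\<close> is
    positive and so is \<open>m\<close>.\<close>
  have mnz: "mn z \<le> 0"
  proof (rule ccontr)
    assume neg: "\<not> mn z \<le> 0"
    have "0 < z i" if "i \<le> d" for i
      using mn_le[OF that, of z] neg by linarith
    then have "0 < (\<Sum>i\<le>d. z i)"
      by (intro sum_pos) auto
    then show False
      using zsum by simp
  qed
  then have m: "0 < m"
    by (simp add: m_def)
  have mz: "1 / real (Suc d) + m * mn z = m"
  proof -
    have "m * (1 - mn z) = 1 / real (Suc d)"
      using mnz by (simp add: m_def divide_simps)
    then show ?thesis
      by (simp add: algebra_simps)
  qed
  have le: "m \<le> y i" if "i \<le> d" for i
  proof -
    have "m * mn z \<le> m * z i"
      using mn_le[OF that, of z] m by (intro mult_left_mono) auto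
    then show ?thesis
      using mz by (simp add: y_def)
  qed
  obtain i0 where i0: "i0 \<le> d" "mn z = z i0"
    by (rule mn_in)
  have mny: "mn y = m"
  proof (rule Min_eqI)
    have "y i0 = m"
      using mz i0(2) by (simp add: y_def)
    then show "m \<in> y ` {..d}"
      using i0(1) by auto
  qed (use le in auto)
  have "(\<Sum>i\<le>d. y i) = 1"
    using zsum by (simp add: y_def sum.distrib sum_distrib_left[symmetric])
  moreover have "0 \<le> y i" if "i \<le> d" for i
    using le[OF that] m by linarith
  ultimately have ys: "y \<in> std_simplex"
    by (simp add: std_simplex_def)
  define Z where "Z = (\<Sum>i=1..d. (z i)\<^sup>2)"
  have wy: "wt y i = m * z i" for i
    by (simp add: y_def)
  have nrm: "nrm y = m\<^sup>2 * Z"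
    unfolding wy Z_def by (simp add: power_mult_distrib sum_distrib_left)
  have "Z = (\<Sum>i=1..d. (p i)\<^sup>2 / (1 - p 0)\<^sup>2)"
    unfolding Z_def by (intro sum.cong refl) (simp add: z_def power_divide)
  also have "\<dots> = (1 - (p 0)\<^sup>2) / (1 - p 0)\<^sup>2"
    using sq by (simp add: sum_divide_distrib[symmetric])
  also have "1 - (p 0)\<^sup>2 = (1 + p 0) * (1 - p 0)"
    by (simp add: power2_eq_square algebra_simps)
  finally have Z: "Z = (1 + p 0) / (1 - p 0)"
    using p1 by (simp add: power2_eq_square)
  have Z1: "Z + 1 = 2 / (1 - p 0)"
    using p1 by (simp add: Z field_simps)
  have Zp: "Z - 1 = 2 * p 0 / (1 - p 0)"
    using p1 by (simp add: Z field_simps)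
  have D: "nrm y + (mn y)\<^sup>2 = m\<^sup>2 * (Z + 1)" "nrm y - (mn y)\<^sup>2 = m\<^sup>2 * (Z - 1)"
    unfolding nrm mny by (simp_all add: algebra_simps)
  have "simplex_to_sphere d y i = p i" for i
  proof -
    consider "i = 0" | "1 \<le> i" "i \<le> d" | "d < i"
      by linarith
    then show ?thesis
    proof cases
      case 1
      show ?thesis
        unfolding 1 simplex_to_sphere_simps(1) D Z1 Zp using m p1 by simp
    next
      case 2
      then show ?thesis
      proof -
        have "simplex_to_sphere d y i = 2 * mn y * wt y i / (m\<^sup>2 * (Z + 1))"
          by (simp only: simplex_to_sphere_simps(2)[OF 2] D(1))
        also have "\<dots> = 2 * m * (m * z i) / (m\<^sup>2 * (2 / (1 - p 0)))"
          by (simp only: wy mny Z1)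
        also have "\<dots> = z i * (1 - p 0)"
          using m p1 by (simp add: power2_eq_square)
        also have "\<dots> = p i"
          using p1 2 by (simp add: z_def)
        finally show ?thesis .
      qed
    qed (simp add: simplex_to_sphere_simps p0)
  qed
  then show thesis
    using ys m mny that by blast
qed

lemma continuous_on_simplex_to_sphere:
  fixes e :: "nat \<Rightarrow> 'v"
  assumes "\<And>x. x \<in> S \<Longrightarrow> x \<circ> e \<in> std_simplex"
  shows "continuous_on S (\<lambda>x. simplex_to_sphere d (x \<circ> e))"
proof (rule continuous_on_coordinatewise_then_product)
  fix i
  have x: "continuous_on S (\<lambda>x. x v)" for v :: 'v
    by (rule continuous_on_coordinate)
  have "continuous_on S (\<lambda>x. Min ((\<lambda>j. x (e j)) ` {..d}))"
    by (rule continuous_on_Min_image) (auto intro: x)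
  then have mn: "continuous_on S (\<lambda>x. mn (x \<circ> e))"
    by (simp add: o_def)
  have wt: "continuous_on S (\<lambda>x. wt (x \<circ> e) i)" for i
    using x by (auto intro!: continuous_intros)
  have nrm: "continuous_on S (\<lambda>x. nrm (x \<circ> e))"
    by (intro continuous_on_sum continuous_on_power wt)
  have ne: "\<forall>x\<in>S. nrm (x \<circ> e) + (mn (x \<circ> e))\<^sup>2 \<noteq> 0"
    using denominator_pos assms by force
  consider "i = 0" | "1 \<le> i" "i \<le> d" | "d < i"
    by linarith
  then show "continuous_on S (\<lambda>x. simplex_to_sphere d (x \<circ> e) i)"
  proof cases
    case 1
    show ?thesis
      unfolding 1 simplex_to_sphere_simps(1)
      by (intro continuous_on_divide continuous_on_diff continuous_on_add continuous_on_power nrm mn ne)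
  next
    case 2
    show ?thesis
      unfolding simplex_to_sphere_simps(2)[OF 2]
      by (intro continuous_on_divide continuous_on_mult continuous_on_add continuous_on_power nrm mn ne wt continuous_on_const)
  qed (simp add: simplex_to_sphere_simps)
qed

end

section \<open>Compactness of realizations\<close>

lemma points_down_closed:
  assumes "\<And>F F'. F \<in> K \<Longrightarrow> F' \<subseteq> F \<Longrightarrow> F' \<in> K"
  shows "points K = (\<Union>F\<in>K. points (Pow F))"
proof (intro set_eqI iffI)
  fix x assume "x \<in> points K"
  then have "{v. x v \<noteq> 0} \<in> K" "x \<in> points (Pow {v. x v \<noteq> 0})"
    by (simp_all add: points_def)
  then show "x \<in> (\<Union>F\<in>K. points (Pow F))"
    by blast
next
  fix x assume "x \<in> (\<Union>F\<in>K. points (Pow F))"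
  then obtain F where "F \<in> K" "x \<in> points (Pow F)"
    by blast
  moreover from this have "{v. x v \<noteq> 0} \<in> K"
    by (intro assms[of F "{v. x v \<noteq> 0}"]) (simp_all add: points_def)
  ultimately show "x \<in> points K"
    by (simp add: points_def)
qed

text \<open>The vertex type may be infinite, so compactness comes from a product of compact factors,
  trivial outside \<open>F\<close>; the sum condition is closed.\<close>

lemma compact_points_Pow:
  assumes "finite F"
  shows "compact (points (Pow F))"
proof -
  let ?S = "\<lambda>v. if v \<in> F then {0..1::real} else {0}"
  have "points (Pow F) = PiE UNIV ?S \<inter> {x. sum x F = 1}"
  proof (intro set_eqI iffI)
    fix x assume "x \<in> points (Pow F)"
    then have x: "\<And>v. 0 \<le> x v" "{v. x v \<noteq> 0} \<subseteq> F" "sum x F = 1"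
      using in_points_iff[OF assms, of "Pow F" x] by auto
    then have "x v \<le> 1" if "v \<in> F" for v
      using member_le_sum[OF that, of x] assms by simp
    then show "x \<in> PiE UNIV ?S \<inter> {x. sum x F = 1}"
      using x by (auto simp: PiE_iff)
  next
    fix x assume x: "x \<in> PiE UNIV ?S \<inter> {x. sum x F = 1}"
    have xv: "x v \<in> ?S v" for v
      using x by (auto simp: PiE_iff)
    have "0 \<le> x v" "x v \<noteq> 0 \<longrightarrow> v \<in> F" for v
      using xv[of v] by (auto split: if_splits)
    then show "x \<in> points (Pow F)"
      using x in_points_iff[OF assms, of "Pow F" x] by auto
  qed
  moreover have "compact (PiE UNIV ?S)"
  proof -
    have "compactin (product_topology (\<lambda>_. euclidean) UNIV) (PiE UNIV ?S)"
      by (subst compactin_PiE) auto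
    then show ?thesis
      by (simp add: euclidean_product_topology)
  qed
  moreover have "closed {x. sum x F = (1::real)}"
    by (intro closed_Collect_eq continuous_on_sum continuous_on_coordinate continuous_on_const)
  ultimately show ?thesis
    by (simp add: compact_Int_closed)
qed

lemma compact_points:
  assumes "finite V" "K \<subseteq> Pow V" "\<And>F F'. F \<in> K \<Longrightarrow> F' \<subseteq> F \<Longrightarrow> F' \<in> K"
  shows "compact (points K)"
proof -
  have "finite K"
    by (rule finite_subset[OF assms(2)]) (simp add: assms(1))
  moreover have "finite F" if "F \<in> K" for F
    using assms(1,2) that by (blast intro: finite_subset)
  ultimately have "compact (\<Union>F\<in>K. points (Pow F))"
    by (intro compact_UN ballI) (auto intro: compact_points_Pow)
  moreover have "points K = (\<Union>F\<in>K. points (Pow F))"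
    using assms(3) by (rule points_down_closed)
  ultimately show ?thesis
    by simp
qed

text \<open>Faces in \<open>C\<close> have equal size, so their boundaries lie in
  \<open>\<Gamma>\<close> and each contributes one sphere. Compactness of the quotient and the
  Hausdorff property of the wedge turn a continuous bijection into a homeomorphism. The nonempty
  face of \<open>\<Gamma>\<close> makes the collapsed point exist.\<close>

lemma collapse_homeomorphic_wedge_of_spheres:
  fixes \<Gamma> C :: "'v set set"
  assumes V: "finite V" "\<Gamma> \<union> C \<subseteq> Pow V"
    and down: "\<And>F F'. F \<in> \<Gamma> \<Longrightarrow> F' \<subseteq> F \<Longrightarrow> F' \<in> \<Gamma>" "\<And>F F'. F \<in> \<Gamma> \<union> C \<Longrightarrow> F' \<subseteq> F \<Longrightarrow> F' \<in> \<Gamma> \<union> C"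
    and C: "\<Gamma> \<inter> C = {}" "\<And>c. c \<in> C \<Longrightarrow> card c = Suc d" and ne: "C \<noteq> {}" "\<exists>F\<in>\<Gamma>. F \<noteq> {}"
  shows "collapse (realization (\<Gamma> \<union> C)) (points \<Gamma>) homeomorphic_space wedge_of_spheres (card C) d"
proof -
  let ?K = "\<Gamma> \<union> C" and ?m = "card C" and ?supp = "\<lambda>x. {v. x v \<noteq> (0::real)}"
  let ?X = "realization ?K" and ?W = "wedge_of_spheres (card C) d"
  let ?S = "sum_topology (\<lambda>_. nsphere d) {..<?m}"
  define B where "B = {(i, sphere_basepoint) | i. i \<in> {..<?m}}"
  have W: "?W = collapse ?S B"
    by (simp add: wedge_of_spheres_def wedge_def B_def)
  have finC: "finite C"
    using V finite_subset[of C "Pow V"] by auto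
  have finc: "finite c" if "c \<in> C" for c
    using C(2)[OF that] card_ge_0_finite by force
  obtain ix where ix: "bij_betw ix C {..<?m}"
    using finC by (metis ex_bij_betw_finite_nat lessThan_atLeast0)
  have "\<forall>c\<in>C. \<exists>f. bij_betw f {..d} c"
  proof
    fix c assume "c \<in> C"
    then have "\<exists>f. bij_betw f {0..<card c} c"
      by (intro ex_bij_betw_nat_finite finc)
    then show "\<exists>f. bij_betw f {..d} c"
      using C(2)[OF \<open>c \<in> C\<close>] by (simp add: atLeast0LessThan lessThan_Suc_atMost)
  qed
  then obtain e where e: "\<And>c. c \<in> C \<Longrightarrow> bij_betw (e c) {..d} c"
    by metis
  have e_sum: "(\<Sum>i\<le>d. x (e c i)) = sum x c" if "c \<in> C" for x :: "'v \<Rightarrow> real" and c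
    using sum.reindex_bij_betw[OF e[OF that], of x] by simp
  have simp_e: "x \<circ> e c \<in> std_simplex d" if "c \<in> C" "x \<in> points (Pow c)" for x c
    using that in_points_iff[OF finc[OF that(1)], of "Pow c" x] e_sum[OF that(1), of x]
    by (simp add: std_simplex_def)
  have mn_e: "Min ((x \<circ> e c) ` {..d}) = Min (x ` c)" if "c \<in> C" for x :: "'v \<Rightarrow> real" and c
    using e[OF that] by (metis bij_betw_imp_surj_on image_comp)
  have cne: "c \<noteq> {}" if "c \<in> C" for c
    using C(2)[OF that] by auto
  have mn_pos: "0 < Min (x ` c) \<longleftrightarrow> c \<subseteq> ?supp x" "Min (x ` c) = 0 \<longleftrightarrow> \<not> c \<subseteq> ?supp x"
    if "c \<in> C" "\<And>v. 0 \<le> x v" for c and x :: "'v \<Rightarrow> real"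
  proof -
    have "0 < Min (x ` c) \<longleftrightarrow> (\<forall>v\<in>c. 0 < x v)"
      using finc[OF that(1)] cne[OF that(1)] by simp
    also have "\<dots> \<longleftrightarrow> c \<subseteq> ?supp x"
      using that(2) by (auto simp: order_less_le)
    finally show 1: "0 < Min (x ` c) \<longleftrightarrow> c \<subseteq> ?supp x" .
    have "0 \<le> Min (x ` c)"
      using finc[OF that(1)] cne[OF that(1)] that(2) by simp
    then show "Min (x ` c) = 0 \<longleftrightarrow> \<not> c \<subseteq> ?supp x"
      using 1 by linarith
  qed
  define \<phi> where "\<phi> c x = (ix c, simplex_to_sphere d (x \<circ> e c))" for c and x :: "'v \<Rightarrow> real"
  define g where "g x = (if ?supp x \<in> C then Some (\<phi> (?supp x) x) else None)" for x :: "'v \<Rightarrow> real"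
  have ixc: "ix c \<in> {..<?m}" if "c \<in> C" for c
    using bij_betwE[OF ix] that by blast
  \<comment> \<open>A boundary point of the simplex \<open>c\<close> has minimum 0 and goes to the
    base point; its support is smaller than \<open>c\<close>, hence not in \<open>C\<close>, so
    \<open>g\<close> is \<open>None\<close> there as well.\<close>
  have g_face: "g x = collapse_map B (\<phi> c x)" if c: "c \<in> C" and x: "x \<in> points (Pow c)" for c x
  proof -
    have x': "\<And>v. 0 \<le> x v" "?supp x \<subseteq> c"
      using x by (auto simp: points_def)
    have "\<phi> c x \<in> B \<longleftrightarrow> Min (x ` c) = 0"
      using simplex_to_sphere_eq_basepoint_iff[OF simp_e[OF c x]] mn_e[OF c] ixc[OF c]
      by (simp add: B_def \<phi>_def)
    also have "\<dots> \<longleftrightarrow> ?supp x \<noteq> c"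
      using mn_pos(2)[OF c x'(1)] x'(2) by auto
    finally have iff: "\<phi> c x \<in> B \<longleftrightarrow> ?supp x \<noteq> c" .
    have "?supp x \<notin> C" if "?supp x \<noteq> c"
    proof
      assume "?supp x \<in> C"
      then have "card (?supp x) = card c"
        using C(2) c by simp
      then show False
        using card_subset_eq[OF finc[OF c] x'(2)] that by blast
    qed
    then show ?thesis
      using iff c by (auto simp: g_def)
  qed
  have g_\<Gamma>: "g x = None" if "x \<in> points \<Gamma>" for x
    using that C(1) by (auto simp: g_def points_def)
  have None_W: "None \<in> topspace ?W"
  proof -
    have "0 < ?m"
      using finC ne(1) by (simp add: card_gt_0_iff)
    then have "(0, sphere_basepoint) \<in> topspace ?S" "(0::nat, sphere_basepoint) \<in> B"
      by (auto simp: B_def sphere_basepoint_in_nsphere)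
    then show ?thesis
      unfolding W topspace_collapse by (metis (mono_tags, lifting) imageI)
  qed
  have HX: "Hausdorff_space ?X"
    unfolding realization_def
    by (intro Hausdorff_space_subtopology) (simp add: Hausdorff_space_product_topology)
  have closed: "closedin ?X (points L)" if L: "L \<subseteq> ?K" "\<And>F F'. F \<in> L \<Longrightarrow> F' \<subseteq> F \<Longrightarrow> F' \<in> L" for L
  proof (rule compactin_imp_closedin[OF HX])
    have "compact (points L)"
      using V(1) order_trans[OF L(1) V(2)] L(2) by (rule compact_points)
    then show "compactin ?X (points L)"
      using points_mono[OF L(1)] by (simp add: realization_eq compactin_subtopology)
  qed
  have face_sub: "Pow c \<subseteq> ?K" if "c \<in> C" for c
    using down(2)[of c] that by blast
  \<comment> \<open>The closed pieces are the subcomplex, indexed by \<open>None\<close>, and the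
    closed simplices on \<open>C\<close>. All local maps agree with \<open>g\<close>, hence with
    each other.\<close>
  have cont_g: "continuous_map ?X ?W g"
  proof (rule pasting_lemma_closed[where I = "insert None (Some ` C)"
        and T = "\<lambda>j. case j of None \<Rightarrow> points \<Gamma> | Some c \<Rightarrow> points (Pow c)"
        and f = "\<lambda>j. case j of None \<Rightarrow> (\<lambda>_. None) | Some c \<Rightarrow> (\<lambda>x. collapse_map B (\<phi> c x))"])
    show "finite (insert None (Some ` C))"
      using finC by simp
    fix j assume "j \<in> insert None (Some ` C)"
    then consider "j = None" | c where "j = Some c" "c \<in> C"
      by blast
    then show "closedin ?X (case j of None \<Rightarrow> points \<Gamma> | Some c \<Rightarrow> points (Pow c))"
    proof cases
      case 1
      have "closedin ?X (points \<Gamma>)"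
        using down(1) by (intro closed) auto
      then show ?thesis by (simp add: 1)
    next
      case 2
      have "closedin ?X (points (Pow c))"
        using face_sub[OF 2(2)] by (intro closed) auto
      then show ?thesis by (simp add: 2)
    qed
    consider "j = None" | c where "j = Some c" "c \<in> C"
      using \<open>j \<in> insert None (Some ` C)\<close> by blast
    then show "continuous_map (subtopology ?X (case j of None \<Rightarrow> points \<Gamma> | Some c \<Rightarrow> points (Pow c))) ?W
        (case j of None \<Rightarrow> (\<lambda>_. None) | Some c \<Rightarrow> (\<lambda>x. collapse_map B (\<phi> c x)))"
    proof cases
      case 1
      then show ?thesis using None_W by simp
    next
      case 2
      let ?T = "top_of_set (points (Pow c))"
      have "continuous_map ?T (nsphere d) (\<lambda>x. simplex_to_sphere d (x \<circ> e c))"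
      proof -
        have "continuous_on (points (Pow c)) (\<lambda>x. simplex_to_sphere d (x \<circ> e c))"
          using simp_e[OF 2(2)] by (rule continuous_on_simplex_to_sphere)
        moreover have "simplex_to_sphere d (x \<circ> e c) \<in> topspace (nsphere d)" if "x \<in> points (Pow c)" for x
          using simp_e[OF 2(2) that] by (rule simplex_to_sphere_in_nsphere)
        ultimately show ?thesis
          unfolding nsphere euclidean_product_topology by (auto simp: continuous_map_in_subtopology)
      qed
      then have "continuous_map ?T ?S (\<phi> c)"
        unfolding \<phi>_def using continuous_map_compose[OF _ continuous_map_component_injection[OF ixc[OF 2(2)]]]
        by (auto simp: o_def)
      then have "continuous_map ?T ?W (collapse_map B \<circ> \<phi> c)"
        unfolding W by (rule continuous_map_compose[OF _ continuous_map_collapse_map])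
      moreover have "subtopology ?X (points (Pow c)) = ?T"
        using points_mono[OF face_sub[OF 2(2)]] by (simp add: realization_eq subtopology_subtopology Int_absorb1)
      ultimately show ?thesis
        by (simp add: 2 o_def)
    qed
  next
    have eq: "(case j of None \<Rightarrow> (\<lambda>_. None) | Some c \<Rightarrow> (\<lambda>x. collapse_map B (\<phi> c x))) x = g x"
      if j: "j \<in> insert None (Some ` C)" and x: "x \<in> (case j of None \<Rightarrow> points \<Gamma> | Some c \<Rightarrow> points (Pow c))" for j x
    proof -
      consider "j = None" | c where "j = Some c" "c \<in> C"
        using j by blast
      then show ?thesis
      proof cases
        case 1
        then show ?thesis using x g_\<Gamma> by simp
      next
        case 2
        then show ?thesis using x g_face by simp
      qed
    qed
    fix i j x
    assume "i \<in> insert None (Some ` C)" "j \<in> insert None (Some ` C)"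
      "x \<in> topspace ?X \<inter> (case i of None \<Rightarrow> points \<Gamma> | Some c \<Rightarrow> points (Pow c))
        \<inter> (case j of None \<Rightarrow> points \<Gamma> | Some c \<Rightarrow> points (Pow c))"
    then show "(case i of None \<Rightarrow> (\<lambda>_. None) | Some c \<Rightarrow> (\<lambda>x. collapse_map B (\<phi> c x))) x =
        (case j of None \<Rightarrow> (\<lambda>_. None) | Some c \<Rightarrow> (\<lambda>x. collapse_map B (\<phi> c x))) x"
      using eq[of i x] eq[of j x] by (simp only: Int_iff)
  next
    fix x assume "x \<in> topspace ?X"
    then have x: "x \<in> points ?K"
      by (simp add: topspace_realization)
    then consider "?supp x \<in> \<Gamma>" | "?supp x \<in> C"
      by (auto simp: points_def)
    then show "\<exists>j. j \<in> insert None (Some ` C) \<and> x \<in> (case j of None \<Rightarrow> points \<Gamma> | Some c \<Rightarrow> points (Pow c)) \<and>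
        g x = (case j of None \<Rightarrow> (\<lambda>_. None) | Some c \<Rightarrow> (\<lambda>x. collapse_map B (\<phi> c x))) x"
    proof cases
      case 1
      then have "x \<in> points \<Gamma>"
        using x by (simp add: points_def)
      then show ?thesis
        using g_\<Gamma> by (intro exI[of _ None]) simp
    next
      case 2
      then have "x \<in> points (Pow (?supp x))"
        using x by (simp add: points_def)
      then show ?thesis
        using g_face[OF 2] 2 by (intro exI[of _ "Some (?supp x)"]) simp
    qed
  qed
  define G where "G p = (case p of None \<Rightarrow> None | Some x \<Rightarrow> g x)" for p
  have Gq: "G (collapse_map (points \<Gamma>) x) = g x" for x
    using g_\<Gamma> by (simp add: G_def)
  let ?Q = "collapse ?X (points \<Gamma>)"
  have Q: "topspace ?Q = collapse_map (points \<Gamma>) ` points ?K"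
    by (simp add: topspace_collapse topspace_realization)
  have cont_G: "continuous_map ?Q ?W G"
  proof (rule continuous_compose_quotient_map[OF quotient_map_collapse])
    show "continuous_map ?X ?W (G \<circ> collapse_map (points \<Gamma>))"
      using cont_g by (simp only: o_def Gq)
  qed
  have "compactin ?X (points ?K)"
    using compact_points[OF V down(2)] by (simp add: realization_eq compactin_subtopology)
  then have comp: "compact_space ?Q"
    unfolding compact_space_def Q by (rule image_compactin[OF _ continuous_map_collapse_map])
  have inj: "inj_on G (topspace ?Q)"
  proof (rule inj_onI)
    fix p p' assume "p \<in> topspace ?Q" "p' \<in> topspace ?Q" and eq: "G p = G p'"
    then obtain x x' where x: "x \<in> points ?K" "p = collapse_map (points \<Gamma>) x"
      and x': "x' \<in> points ?K" "p' = collapse_map (points \<Gamma>) x'"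
      unfolding Q by blast
    have gx: "g x = g x'"
      using eq unfolding x(2) x'(2) Gq .
    have in_\<Gamma>: "x \<in> points \<Gamma>" if "x \<in> points ?K" "?supp x \<notin> C" for x
      using that by (simp add: points_def)
    show "p = p'"
    proof (cases "?supp x \<in> C")
      case False
      then have "g x' = None"
        using gx by (simp add: g_def)
      then have "?supp x' \<notin> C"
        by (auto simp: g_def)
      then show ?thesis
        using in_\<Gamma>[OF x(1) False] in_\<Gamma>[OF x'(1)] x(2) x'(2) by simp
    next
      case True
      define c where "c = ?supp x"
      have c: "c \<in> C"
        using True by (simp add: c_def)
      have True': "?supp x' \<in> C"
        using gx True by (auto simp: g_def split: if_splits)
      then have \<phi>: "\<phi> (?supp x) x = \<phi> (?supp x') x'"
        using gx True by (simp add: g_def)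
      then have supp: "?supp x' = c"
        using bij_betw_imp_inj_on[OF ix] True True' unfolding \<phi>_def c_def by (auto dest: inj_onD)
      have pc: "x \<in> points (Pow c)" "x' \<in> points (Pow c)"
        using x(1) x'(1) supp by (auto simp: points_def c_def)
      have nn: "0 \<le> x v" "0 \<le> x' v" for v
        using x(1) x'(1) by (auto simp: points_def)
      have eqs: "simplex_to_sphere d (x \<circ> e c) = simplex_to_sphere d (x' \<circ> e c)"
        using \<phi> unfolding supp c_def[symmetric] by (simp add: \<phi>_def)
      have pos: "0 < Min ((x \<circ> e c) ` {..d})" "0 < Min ((x' \<circ> e c) ` {..d})"
        unfolding mn_e[OF c] using mn_pos(1)[OF c nn(1)] mn_pos(1)[OF c nn(2)] supp c_def by simp_all
      have "x v = x' v" for v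
      proof (cases "v \<in> c")
        case True
        then obtain i where "i \<le> d" "v = e c i"
          using bij_betw_imp_surj_on[OF e[OF c]] by auto
        then show ?thesis
          using simplex_to_sphere_inj[OF simp_e[OF c pc(1)] pos(1) simp_e[OF c pc(2)] pos(2) eqs] by simp
      next
        case False
        then have "x v = 0" "x' v = 0"
          using supp unfolding c_def by blast+
        then show ?thesis
          by simp
      qed
      then have "x = x'"
        by (rule ext)
      then show ?thesis
        unfolding x(2) x'(2) by simp
    qed
  qed
  have "G ` topspace ?Q = topspace ?W"
  proof
    show "G ` topspace ?Q \<subseteq> topspace ?W"
      by (rule continuous_map_image_subset_topspace[OF cont_G])
    show "topspace ?W \<subseteq> G ` topspace ?Q"
    proof
      fix w assume "w \<in> topspace ?W"
      then obtain z where z: "z \<in> topspace ?S" "w = collapse_map B z"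
        unfolding W topspace_collapse by blast
      obtain i p where "z = (i, p)"
        by fastforce
      then have w: "w = collapse_map B (i, p)" and i: "i < ?m" and p: "p \<in> topspace (nsphere d)"
        using z by simp_all
      show "w \<in> G ` topspace ?Q"
      proof (cases "p = sphere_basepoint")
        case True
        then have "w = None"
          using w i by (simp add: B_def)
        \<comment> \<open>The wedge point is hit by any point of the subcomplex, for instance a
          vertex.\<close>
        obtain F v where "F \<in> \<Gamma>" "v \<in> F"
          using ne(2) by blast
        then have "{v} \<in> \<Gamma>"
          using down(1)[of F "{v}"] by simp
        then have "(\<lambda>u. if u = v then 1 else 0) \<in> points \<Gamma>"
          by (simp add: points_def)
        then obtain x where "x \<in> points \<Gamma>"
          by blast
        moreover from this have "x \<in> points ?K"
          using points_mono[of \<Gamma> ?K] by blast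
        moreover have "w = G (collapse_map (points \<Gamma>) x)"
          unfolding Gq \<open>w = None\<close> by (rule g_\<Gamma>[OF calculation(1), symmetric])
        ultimately show ?thesis
          unfolding Q by blast
      next
        case False
        then have w': "w = Some (i, p)"
          using w by (simp add: B_def)
        obtain c where c: "c \<in> C" "ix c = i"
          using bij_betw_imp_surj_on[OF ix] i by (metis imageE lessThan_iff)
        obtain y where y: "y \<in> std_simplex d" "0 < Min (y ` {..d})" "simplex_to_sphere d y = p"
          by (rule simplex_to_sphere_surj[OF p False])
        \<comment> \<open>\<open>y\<close> is transported along the enumeration of \<open>c\<close>;
          its coordinates are positive, so the support is exactly \<open>c\<close>.\<close>
        define x where "x v = (if v \<in> c then y (inv_into {..d} (e c) v) else 0)" for v
        have xe: "x (e c j) = y j" if "j \<le> d" for j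
          using e[OF c(1)] that by (simp add: x_def bij_betw_inv_into_left bij_betw_apply)
        have ypos: "0 < y j" if "j \<le> d" for j
          using y(2) that by simp
        have xpos: "0 < x v" if v: "v \<in> c" for v
        proof -
          obtain j where "j \<le> d" "v = e c j"
            using bij_betw_imp_surj_on[OF e[OF c(1)]] v by auto
          then show ?thesis
            using xe ypos by simp
        qed
        then have supp: "?supp x = c"
          by (force simp: x_def)
        have "sum x c = 1"
          using e_sum[OF c(1), of x] xe y(1) by (simp add: std_simplex_def)
        moreover have "0 \<le> x v" for v
          using xpos[of v] by (cases "v \<in> c") (auto simp: x_def)
        ultimately have "x \<in> points ?K"
          using supp c(1) by (simp add: points_def)
        moreover have "simplex_to_sphere d (x \<circ> e c) = p"
          unfolding y(3)[symmetric] by (rule simplex_to_sphere_cong) (simp add: xe)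
        then have "g x = w"
          using supp c w' by (simp add: g_def \<phi>_def)
        then have "w = G (collapse_map (points \<Gamma>) x)"
          by (simp only: Gq)
        ultimately show ?thesis
          unfolding Q by blast
      qed
    qed
  qed
  then have "homeomorphic_map ?Q ?W G"
    by (intro continuous_imp_homeomorphic_map cont_G comp Hausdorff_wedge_of_spheres inj)
  then show ?thesis
    by (rule homeomorphic_map_imp_homeomorphic_space)
qed

section \<open>Assembling the homotopy equivalence\<close>

lemma empty_in_NBFC:
  assumes "1 \<le> q" "q < s"
  shows "{} \<in> NBFC q s"
proof -
  have "{} \<notin> surplus_graphs q {1..s}"
    using assms(1) surplus_graphs_card[of "{}" q "{1..s}" "{1..q}"] by auto
  then show ?thesis
    using factor_critical_iff_surplus[OF assms(2)] by (simp add: NBFC_def)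
qed

theorem theorem1p9:
  fixes q s :: nat
  assumes "1 \<le> q" and "q < s"
  shows "BFC q s homotopy_equivalent_space wedge_of_spheres ((s - 1) choose q) (2 * q - 1)"
proof -
  let ?V = "{1..q} \<times> {1..s}" and ?\<Gamma> = "NBFC q s" and ?d = "2 * q - 1"
  have V: "finite ?V" "full_simplex q s = Pow ?V"
    by (simp_all add: full_simplex_def)
  have \<Gamma>: "?\<Gamma> \<subseteq> Pow ?V"
    using NBFC_subset[of q s] unfolding V(2) .
  obtain C where C: "matchable (Pow ?V - ?\<Gamma>) C" "card C = (s - 1) choose q" "\<And>c. c \<in> C \<Longrightarrow> card c = 2 * q"
    using ex_matchable_not_NBFC[OF assms(2)] V(2) by auto
  have fin: "finite F" if "F \<subseteq> ?V" for F
    using that V(1) by (rule finite_subset)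
  have "\<exists>A B. Pow ?V - ?\<Gamma> = A \<union> C \<union> B \<and> A \<inter> C = {} \<and> B \<inter> (A \<union> C) = {} \<and> matchable A {} \<and>
      matchable B {} \<and> (\<forall>a\<in>A. card a \<le> 2 * q) \<and> (\<forall>b\<in>B. 2 * q \<le> card b)"
  proof (rule matchable_split[OF C(1)])
    show "finite F" if "F \<in> Pow ?V - ?\<Gamma>" for F
      using that by (intro fin) simp
  qed (rule C(3))
  then obtain A B where AB: "Pow ?V - ?\<Gamma> = A \<union> C \<union> B" "A \<inter> C = {}" "B \<inter> (A \<union> C) = {}"
      "matchable A {}" "matchable B {}" "\<forall>a\<in>A. card a \<le> 2 * q" "\<forall>b\<in>B. 2 * q \<le> card b"
    by (elim exE conjE) (rule that)
  have sub: "A \<subseteq> Pow ?V" "C \<subseteq> Pow ?V" "B \<subseteq> Pow ?V" "A \<inter> ?\<Gamma> = {}" "C \<inter> ?\<Gamma> = {}" "B \<inter> ?\<Gamma> = {}"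
    using AB(1) by blast+
  have all: "?\<Gamma> \<union> A \<union> C \<union> B = Pow ?V"
    using AB(1) \<Gamma> by blast
  \<comment> \<open>Settles the ties at size \<open>2 * q\<close> in the two closure arguments that
    follow.\<close>
  have same: "F' = F" if "F' \<subseteq> F" "F \<subseteq> ?V" "card F \<le> card F'" for F F'
    using card_seteq[OF fin[OF that(2)] that(1,3)] .
  have down1: "F' \<in> ?\<Gamma> \<union> A" if F: "F \<in> ?\<Gamma> \<union> A" "F' \<subseteq> F" for F F'
  proof (cases "F \<in> ?\<Gamma>")
    case True
    then show ?thesis
      using NBFC_downward_closed F(2) by blast
  next
    case False
    then have A: "F \<in> A" using F(1) by blast
    then have FV: "F \<subseteq> ?V" using sub(1) by blast
    have "F' = F" if "F' \<in> C \<union> B"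
      using same[OF F(2) FV] bspec[OF AB(6) A] C(3)[of F'] bspec[OF AB(7), of F'] that by fastforce
    then have "F' \<notin> C \<union> B"
      using A AB(2,3) by blast
    moreover have "F' \<in> ?\<Gamma> \<union> A \<union> C \<union> B"
      using F(2) FV unfolding all by blast
    ultimately show ?thesis by blast
  qed
  have down2: "F' \<in> ?\<Gamma> \<union> A \<union> C" if F: "F \<in> ?\<Gamma> \<union> A \<union> C" "F' \<subseteq> F" for F F'
  proof (cases "F \<in> ?\<Gamma> \<union> A")
    case True
    then show ?thesis
      using down1 F(2) by blast
  next
    case False
    then have c: "F \<in> C" using F(1) by blast
    then have FV: "F \<subseteq> ?V" using sub(2) by blast
    have "F' = F" if "F' \<in> B"
      using same[OF F(2) FV] C(3)[OF c] bspec[OF AB(7) that] by simp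
    then have "F' \<notin> B"
      using c AB(3) by blast
    moreover have "F' \<in> ?\<Gamma> \<union> A \<union> C \<union> B"
      using F(2) FV unfolding all by blast
    ultimately show ?thesis by blast
  qed
  \<comment> \<open>Here \<open>1 \<le> q\<close> enters: for \<open>q = 0\<close> the empty graph
    would be factor critical.\<close>
  have empty: "{} \<in> ?\<Gamma>"
    using assms by (rule empty_in_NBFC)

  have "BFC q s = collapse (realization (Pow ?V)) (points ?\<Gamma>)"
    by (simp only: BFC_def quotient_complex_def V(2) topspace_realization)
  \<comment> \<open>Collapsing the low pairs out of the denominator is read backwards, so that the
    subcomplex grows.\<close>
  also have "\<dots> homotopy_equivalent_space collapse (realization (Pow ?V)) (points (?\<Gamma> \<union> A))"
  proof (subst homotopy_equivalent_space_sym, rule collapse_matchable_denominator[OF AB(4) refl V(1) sub(1) \<Gamma> empty sub(4)])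
    show "F' \<in> ?\<Gamma>" if "F \<in> ?\<Gamma>" "F' \<subseteq> F" for F F'
      using that by (rule NBFC_downward_closed)
  qed (rule down1)
  also have "collapse (realization (Pow ?V)) (points (?\<Gamma> \<union> A)) homotopy_equivalent_space
      collapse (realization (?\<Gamma> \<union> A \<union> C)) (points (?\<Gamma> \<union> A))"
  proof (subst all[symmetric], rule collapse_matchable_numerator[OF AB(5) refl V(1) sub(3)])
    show "?\<Gamma> \<union> A \<union> C \<subseteq> Pow ?V" "{} \<in> ?\<Gamma> \<union> A \<union> C" "?\<Gamma> \<union> A \<subseteq> ?\<Gamma> \<union> A \<union> C"
      using \<Gamma> sub(1,2) empty by blast+
    show "B \<inter> (?\<Gamma> \<union> A \<union> C) = {}"
      using AB(3) sub(6) by blast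
    show "F' \<in> ?\<Gamma> \<union> A \<union> C \<union> B" if "F \<in> ?\<Gamma> \<union> A \<union> C \<union> B" "F' \<subseteq> F" for F F'
      using that unfolding all by blast
  qed (rule down2)
  also have "collapse (realization (?\<Gamma> \<union> A \<union> C)) (points (?\<Gamma> \<union> A)) homotopy_equivalent_space
      wedge_of_spheres (card C) ?d"
  proof (rule homeomorphic_imp_homotopy_equivalent_space,
      rule collapse_homeomorphic_wedge_of_spheres[OF V(1) _ down1 down2])
    show "?\<Gamma> \<union> A \<union> C \<subseteq> Pow ?V"
      using \<Gamma> sub(1,2) by blast
    show "(?\<Gamma> \<union> A) \<inter> C = {}"
      using sub(5) AB(2) by blast
    show "card c = Suc ?d" if "c \<in> C" for c
      using C(3)[OF that] assms(1) by simp
    have "0 < card C"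
      unfolding C(2) using assms(2) by (intro zero_less_binomial) simp
    then show "C \<noteq> {}"
      by auto
    then obtain c where c: "c \<in> C"
      by blast
    then have "c \<noteq> {}"
      using C(3)[OF c] assms(1) by auto
    then obtain v where "v \<in> c"
      by blast
    \<comment> \<open>A vertex of a critical face is not critical, as \<open>2 * q\<close> is not 1,
      so it lies in the enlarged subcomplex.\<close>
    then have "{v} \<in> ?\<Gamma> \<union> A \<union> C"
      using c down2[of c "{v}"] by blast
    moreover have "{v} \<notin> C"
      using C(3)[of "{v}"] by auto
    ultimately show "\<exists>F\<in>?\<Gamma> \<union> A. F \<noteq> {}"
      by blast
  qed
  finally show ?thesis
    by (simp only: C(2))
qed

end
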